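(* Let $N\in\mathbb N$ and fix a vertex $\varkappa$ of $H(N,2)$, with subconstituent algebra $T=T(\varkappa)$. For $(r,s,t,u)\in\mathcal P_N$ the map $\vartheta:P_N\to T$ sends $$x^ry^sz^tw^u\mapsto\frac{r!s!t!u!}{(N!)^{1/2}}\,{\sf E}_j^*{\sf A}_h{\sf E}_i^*,\qquad\qquad x^{*r}y^{*s}z^{*t}w^{*u}\mapsto\frac{r!s!t!u!}{(N!)^{1/2}}\,{\sf E}_i{\sf A}_h^*{\sf E}_j,$$ where $h=t+u$, $i=u+s$, $j=s+t$.
   Context: $\mathbb N=\{0,1,2,\ldots\}$; all vector spaces are over $\mathbb C$. $P=\mathbb C[x,y,z,w]$, $P_N$ is the subspace of homogeneous polynomials of total degree $N$, $\mathcal P_N$ is the set of $(r,s,t,u)\in\mathbb N^4$ with $r+s+t+u=N$, and $x^*=\frac{x+y+z+w}2$, $y^*=\frac{x+y-z-w}2$, $z^*=\frac{x-y+z-w}2$, $w^*=\frac{x-y-z+w}2$ in $P_1$. Hypercube: $H(N,2)$ is the graph with vertex set $X=\{1,-1\}^N$, two vertices adjacent when they differ in exactly one coordinate; $\partial$ is path-length distance; $\Gamma_i(x)=\{y\in X:\partial(x,y)=i\}$. $V$ is the vector space with basis $X$, with the Hermitian form (linear in the first argument) for which $X$ is orthonormal. $V^{\otimes3}$ has basis $X^{\otimes 3}=\{x\otimes y\otimes z:x,y,z\in X\}$. $G$ is the automorphism group of the graph, acting linearly on $V$ by permuting $X$ and diagonally on $V^{\otimes 3}$; ${\rm Fix}(G)=\{v\in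 V^{\otimes3}:g(v)=v\ \forall g\in G\}$. Put $\theta_i=\theta_i^*=N-2i$. ${\sf A}_h\in{\rm End}(V)$ is given by ${\sf A}_hx=\sum_{\xi\in\Gamma_h(x)}\xi$ for $x\in X$; the adjacency map ${\sf A}$ sends each vertex to the sum of its neighbours and is diagonalizable with eigenvalues $\theta_i$ $(0\le i\le N)$; ${\sf E}_i$ is the primitive idempotent of ${\sf A}$ for $\theta_i$ (projection onto that eigenspace along the other eigenspaces). For $x\in X$: ${\sf A}^*x=\theta^*_{\partial(x,\varkappa)}x$; ${\sf E}_i^*x=x$ if $\partial(x,\varkappa)=i$ and ${\sf E}^*_ix=0$ otherwise; ${\sf A}^*_hx=2^N\langle{\sf E}_h\varkappa,x\rangle x$. $T$ is the subalgebra of ${\rm End}(V)$ generated by ${\sf A},{\sf A}^*$. The profile of $x\otimes y\otimes z\in X^{\otimes 3}$ is $(r,s,t,u)\in\mathcal P_N$, where $r=|\{i:x_i=y_i=z_i\}|$, $s=|\{i:x_i\ne y_i=z_i\}|$, $t=|\{i:y_i\neq z_i=x_i\}|$, $u=|\{i:z_i\ne x_i=y_i\}|$. $B(r,s,t,u)$ is the sum of all elements of $X^{\otimes3}$ with profile $(r,s,t,u)$ and $\tilde B(r,s,t,u)=\frac{r!s!t!u!}{N!\,2^N}B(r,s,t,u)$; these form a basis of ${\rm Fix}(G)$. The linear isomorphism $\ddag:P_N\to{\rm Fix}(G)$ sends $x^ry^sz^tw^u\mapsto(N!\,2^N)^{1/2}\tilde B(r,s,t,u)$ for $(r,s,t,u)\in\mathcal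 P_N$. With $e_{x,y}\in{\rm End}(V)$ sending $y\mapsto x$ and all other vertices to $0$, the linear map $\varepsilon:V^{\otimes 3}\to{\rm End}(V)$ is given by $\varepsilon(x\otimes y\otimes z)=2^{N/2}e_{y,z}$ if $x=\varkappa$ and $0$ if $x\ne\varkappa$ $(x,y,z\in X)$; it maps ${\rm Fix}(G)$ bijectively onto $T$. The map $\vartheta:P_N\to T$ is the composition $f\mapsto\varepsilon(f^\ddag)$. *)

theory Defs
  imports Complex_Main "HOL-Library.FuncSet" "HOL-Library.Function_Algebras"
    "HOL-Library.Product_Plus" "HOL-Library.Poly_Mapping"
begin

section \<open>The hypercube\<close>

type_synonym vertex = "nat \<Rightarrow> int"

definition hypercube :: "nat \<Rightarrow> vertex set" where
  "hypercube N = ({..<N} \<rightarrow>\<^sub>E {1, -1})"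

definition hc_edges :: "nat \<Rightarrow> (vertex \<times> vertex) set" where
  "hc_edges N = {(x, y). x \<in> hypercube N \<and> y \<in> hypercube N \<and> card {k. k < N \<and> x k \<noteq> y k} = 1}"

text \<open>Path-length distance: a walk of least length is a path. The value is only meaningful for
  vertices of the hypercube, which is connected.\<close>

definition hc_dist :: "nat \<Rightarrow> vertex \<Rightarrow> vertex \<Rightarrow> nat" where
  "hc_dist N x y = (LEAST n. (x, y) \<in> hc_edges N ^^ n)"

definition sphere_at :: "nat \<Rightarrow> nat \<Rightarrow> vertex \<Rightarrow> vertex set" where
  "sphere_at N i x = {y \<in> hypercube N. hc_dist N x y = i}"


section \<open>The space \<open>V\<close> and its endomorphisms\<close>

text \<open>The vector space with basis \<open>X\<close> consists of the complex functions that vanish outside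
  \<open>X\<close>. An endomorphism of \<open>V\<close> is a HOL function which is linear on \<open>V\<close> and is by convention \<open>0\<close>
  outside \<open>V\<close>; thus equality, sum and composition of endomorphisms are the ones of HOL functions.
  Zero, sums and differences of functions are pointwise.\<close>

type_synonym vec = "vertex \<Rightarrow> complex"
type_synonym endo = "vec \<Rightarrow> vec"

definition basis_vec :: "'a \<Rightarrow> 'a \<Rightarrow> complex" where
  "basis_vec x = (\<lambda>y. if y = x then 1 else 0)"

definition vscale :: "complex \<Rightarrow> ('a \<Rightarrow> complex) \<Rightarrow> 'a \<Rightarrow> complex" where
  "vscale c v = (\<lambda>y. c * v y)"

definition escale :: "complex \<Rightarrow> endo \<Rightarrow> endo" where
  "escale c F = (\<lambda>v. vscale c (F v))"

definition Vsp :: "nat \<Rightarrow> vec set" where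
  "Vsp N = {v. \<forall>x. x \<notin> hypercube N \<longrightarrow> v x = 0}"

definition herm :: "nat \<Rightarrow> vec \<Rightarrow> vec \<Rightarrow> complex" where
  "herm N v w = (\<Sum>x\<in>hypercube N. v x * cnj (w x))"

definition End_V :: "nat \<Rightarrow> endo set" where
  "End_V N = {F. (\<forall>v\<in>Vsp N. F v \<in> Vsp N)
     \<and> (\<forall>v\<in>Vsp N. \<forall>w\<in>Vsp N. F (v + w) = F v + F w)
     \<and> (\<forall>c. \<forall>v\<in>Vsp N. F (vscale c v) = vscale c (F v))
     \<and> (\<forall>v. v \<notin> Vsp N \<longrightarrow> F v = 0)}"

text \<open>The endomorphism with prescribed values \<open>\<phi> x\<close> on the basis vectors \<open>x\<close>.\<close>

definition lin_ext :: "nat \<Rightarrow> (vertex \<Rightarrow> vec) \<Rightarrow> endo" where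
  "lin_ext N \<phi> = (\<lambda>v. if v \<in> Vsp N then (\<Sum>x\<in>hypercube N. vscale (v x) (\<phi> x)) else 0)"

definition elem_endo :: "nat \<Rightarrow> vertex \<Rightarrow> vertex \<Rightarrow> endo" where
  "elem_endo N x y = lin_ext N (\<lambda>\<xi>. if \<xi> = y then basis_vec x else 0)"

definition id_V :: "nat \<Rightarrow> endo" where
  "id_V N = lin_ext N basis_vec"


section \<open>Adjacency, dual adjacency, idempotents and the subconstituent algebra\<close>

definition theta :: "nat \<Rightarrow> nat \<Rightarrow> complex" where
  "theta N i = of_nat N - 2 * of_nat i"

definition A_dist :: "nat \<Rightarrow> nat \<Rightarrow> endo" where
  "A_dist N h = lin_ext N (\<lambda>x. \<Sum>\<xi>\<in>sphere_at N h x. basis_vec \<xi>)"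

definition A_adj :: "nat \<Rightarrow> endo" where
  "A_adj N = lin_ext N (\<lambda>x. \<Sum>\<xi> | (x, \<xi>) \<in> hc_edges N. basis_vec \<xi>)"

definition eigenspace :: "nat \<Rightarrow> endo \<Rightarrow> complex \<Rightarrow> vec set" where
  "eigenspace N F c = {v \<in> Vsp N. F v = vscale c v}"

text \<open>Since the adjacency map is diagonalizable with eigenvalues \<open>theta N j\<close> for \<open>j \<le> N\<close>,
  the description below determines a unique endomorphism when \<open>i \<le> N\<close>.\<close>

definition E_idem :: "nat \<Rightarrow> nat \<Rightarrow> endo" where
  "E_idem N i = (THE F. F \<in> End_V N
     \<and> (\<forall>v\<in>eigenspace N (A_adj N) (theta N i). F v = v)
     \<and> (\<forall>j\<le>N. j \<noteq> i \<longrightarrow> (\<forall>v\<in>eigenspace N (A_adj N) (theta N j). F v = 0)))"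

definition A_dual :: "nat \<Rightarrow> vertex \<Rightarrow> endo" where
  "A_dual N \<kappa> = lin_ext N (\<lambda>x. vscale (theta N (hc_dist N x \<kappa>)) (basis_vec x))"

definition E_dual :: "nat \<Rightarrow> vertex \<Rightarrow> nat \<Rightarrow> endo" where
  "E_dual N \<kappa> i = lin_ext N (\<lambda>x. if hc_dist N x \<kappa> = i then basis_vec x else 0)"

definition A_dual_dist :: "nat \<Rightarrow> vertex \<Rightarrow> nat \<Rightarrow> endo" where
  "A_dual_dist N \<kappa> h = lin_ext N
     (\<lambda>x. vscale (2 ^ N * herm N (E_idem N h (basis_vec \<kappa>)) (basis_vec x)) (basis_vec x))"

inductive_set subconst_alg :: "nat \<Rightarrow> vertex \<Rightarrow> endo set" for N :: nat and \<kappa> :: vertex where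
  one: "id_V N \<in> subconst_alg N \<kappa>"
| adj: "A_adj N \<in> subconst_alg N \<kappa>"
| dual: "A_dual N \<kappa> \<in> subconst_alg N \<kappa>"
| add: "F \<in> subconst_alg N \<kappa> \<Longrightarrow> F' \<in> subconst_alg N \<kappa> \<Longrightarrow> F + F' \<in> subconst_alg N \<kappa>"
| scale: "F \<in> subconst_alg N \<kappa> \<Longrightarrow> escale c F \<in> subconst_alg N \<kappa>"
| comp: "F \<in> subconst_alg N \<kappa> \<Longrightarrow> F' \<in> subconst_alg N \<kappa> \<Longrightarrow> F \<circ> F' \<in> subconst_alg N \<kappa>"


section \<open>Homogeneous polynomials in four variables\<close>

text \<open>A polynomial is a finitely supported function from exponents \<open>(r, s, t, u)\<close> to
  coefficients; the product is convolution with respect to addition of exponents.\<close>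

type_synonym poly4 = "(nat \<times> nat \<times> nat \<times> nat) \<Rightarrow>\<^sub>0 complex"

definition varx :: poly4 where "varx = Poly_Mapping.single (1, 0, 0, 0) 1"
definition vary :: poly4 where "vary = Poly_Mapping.single (0, 1, 0, 0) 1"
definition varz :: poly4 where "varz = Poly_Mapping.single (0, 0, 1, 0) 1"
definition varw :: poly4 where "varw = Poly_Mapping.single (0, 0, 0, 1) 1"

definition constp :: "complex \<Rightarrow> poly4" where
  "constp c = Poly_Mapping.single 0 c"

definition varx_dual :: poly4 where "varx_dual = constp (1/2) * (varx + vary + varz + varw)"
definition vary_dual :: poly4 where "vary_dual = constp (1/2) * (varx + vary - varz - varw)"
definition varz_dual :: poly4 where "varz_dual = constp (1/2) * (varx - vary + varz - varw)"
definition varw_dual :: poly4 where "varw_dual = constp (1/2) * (varx - vary - varz + varw)"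

definition profiles :: "nat \<Rightarrow> (nat \<times> nat \<times> nat \<times> nat) set" where
  "profiles N = {(r, s, t, u). r + s + t + u = N}"

definition homog :: "nat \<Rightarrow> poly4 set" where
  "homog N = {f. Poly_Mapping.keys f \<subseteq> profiles N}"


section \<open>Triple tensors and the map from polynomials to the subconstituent algebra\<close>

text \<open>The third tensor power of \<open>V\<close> consists of the complex functions on triples of vertices that
  vanish outside \<open>triples N\<close>; the triple \<open>(x, y, z)\<close> stands for the pure tensor of \<open>x, y, z\<close>.\<close>

type_synonym tensor3 = "vertex \<times> vertex \<times> vertex \<Rightarrow> complex"

definition triples :: "nat \<Rightarrow> (vertex \<times> vertex \<times> vertex) set" where
  "triples N = hypercube N \<times> hypercube N \<times> hypercube N"

fun profile :: "nat \<Rightarrow> vertex \<times> vertex \<times> vertex \<Rightarrow> nat \<times> nat \<times> nat \<times> nat" where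
  "profile N (x, y, z) =
    (card {k. k < N \<and> x k = y k \<and> y k = z k},
     card {k. k < N \<and> x k \<noteq> y k \<and> y k = z k},
     card {k. k < N \<and> y k \<noteq> z k \<and> z k = x k},
     card {k. k < N \<and> z k \<noteq> x k \<and> x k = y k})"

definition B_vec :: "nat \<Rightarrow> nat \<times> nat \<times> nat \<times> nat \<Rightarrow> tensor3" where
  "B_vec N p = (\<Sum>q | q \<in> triples N \<and> profile N q = p. basis_vec q)"

fun B_tilde :: "nat \<Rightarrow> nat \<times> nat \<times> nat \<times> nat \<Rightarrow> tensor3" where
  "B_tilde N (r, s, t, u) =
     vscale (fact r * fact s * fact t * fact u / (fact N * 2 ^ N)) (B_vec N (r, s, t, u))"

text \<open>The linear map with the prescribed values on the monomials of degree \<open>N\<close>.\<close>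

definition ddag :: "nat \<Rightarrow> poly4 \<Rightarrow> tensor3" where
  "ddag N f = (\<Sum>p\<in>profiles N. vscale (Poly_Mapping.lookup f p)
     (vscale (complex_of_real (sqrt (fact N * 2 ^ N))) (B_tilde N p)))"

definition eps_map :: "nat \<Rightarrow> vertex \<Rightarrow> tensor3 \<Rightarrow> endo" where
  "eps_map N \<kappa> a = (\<Sum>(x, y, z)\<in>triples N. escale (a (x, y, z))
     (if x = \<kappa> then escale (complex_of_real (2 powr (real N / 2))) (elem_endo N y z) else 0))"

definition vartheta :: "nat \<Rightarrow> vertex \<Rightarrow> poly4 \<Rightarrow> endo" where
  "vartheta N \<kappa> f = eps_map N \<kappa> (ddag N f)"

end

theory Submission
  imports Defs
begin

text \<open>All endomorphisms are treated as matrices. The map \<open>\<vartheta>\<close> multiplies the coefficient of the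
  monomial with exponent \<open>p = (r, s, t, u)\<close> by \<open>r! s! t! u! / sqrt (N!)\<close> and puts it at the positions
  \<open>(y, z)\<close> for which \<open>(\<kappa>, y, z)\<close> has profile \<open>p\<close>; since a profile is determined by the three distances, this
  gives the first formula. For the second one, expand \<open>E\<^sub>i A\<^sup>*\<^sub>h E\<^sub>j\<close> in the characters \<open>\<chi>\<^sub>S\<close> of the group
  \<open>{1, -1}\<^sup>N\<close>: by orthogonality its entries are \<open>2\<^sup>-\<^sup>N\<close> times a sum over pairs \<open>(S, T)\<close> with \<open>|S| = i\<close>,
  \<open>|T| = j\<close>, \<open>|S \<Delta> T| = h\<close>. Such a pair is a word of length \<open>N\<close> in four letters with content \<open>p\<close>, and so is a
  pair \<open>(y, z)\<close> relative to \<open>\<kappa>\<close>. Expanding the product of the dual variables yields the same sum with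
  the roles of the two words exchanged, and double counting by multinomial coefficients relates both.\<close>

section \<open>Linear maps given by matrices\<close>

lemma finite_hypercube [simp]: "finite (hypercube N)"
  by (simp add: hypercube_def finite_PiE)

lemma sum_fun_apply: "(\<Sum>a\<in>A. f a) x = (\<Sum>a\<in>A. f a x)"
  for f :: "'a \<Rightarrow> 'b \<Rightarrow> 'c::comm_monoid_add"
  by (induction A rule: infinite_finite_induct) (auto simp: zero_fun_def plus_fun_def)

text \<open>Row index first: \<open>K x y\<close> is the coefficient of \<open>x\<close> in the
  image of \<open>y\<close>. The cutoff outside the hypercube makes every function \<open>K\<close>
  yield an endomorphism of \<open>V\<close>.\<close>

definition kern :: "nat \<Rightarrow> (vertex \<Rightarrow> vertex \<Rightarrow> complex) \<Rightarrow> endo" where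
  "kern N K = lin_ext N (\<lambda>y x. if x \<in> hypercube N then K x y else 0)"

lemma lin_ext_apply:
  "lin_ext N \<phi> v x = (if v \<in> Vsp N then \<Sum>y\<in>hypercube N. v y * \<phi> y x else 0)"
  by (simp add: lin_ext_def sum_fun_apply vscale_def zero_fun_def)

lemma kern_apply:
  "kern N K v x = (if v \<in> Vsp N \<and> x \<in> hypercube N then \<Sum>y\<in>hypercube N. K x y * v y else 0)"
  by (auto simp: kern_def lin_ext_apply mult.commute)

lemma lin_ext_eq_kern:
  assumes "\<And>x y. x \<in> hypercube N \<Longrightarrow> y \<in> hypercube N \<Longrightarrow> \<phi> y x = K x y"
    and "\<And>x y. x \<notin> hypercube N \<Longrightarrow> y \<in> hypercube N \<Longrightarrow> \<phi> y x = 0"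
  shows "lin_ext N \<phi> = kern N K"
  unfolding kern_def
  by (rule ext, rule ext, simp only: lin_ext_apply) (auto intro!: sum.cong simp: assms)

lemma kern_cong:
  assumes "\<And>x y. x \<in> hypercube N \<Longrightarrow> y \<in> hypercube N \<Longrightarrow> K x y = L x y"
  shows "kern N K = kern N L"
  by (rule ext, rule ext) (auto simp: kern_apply assms intro!: sum.cong)

lemma kern_Vsp: "kern N K v \<in> Vsp N"
  by (simp add: Vsp_def kern_apply)

lemma kern_comp: "kern N K \<circ> kern N L = kern N (\<lambda>x y. \<Sum>z\<in>hypercube N. K x z * L z y)"
proof (rule ext, rule ext)
  fix v x
  have "(\<Sum>z\<in>hypercube N. K x z * (\<Sum>y\<in>hypercube N. L z y * v y))
    = (\<Sum>y\<in>hypercube N. (\<Sum>z\<in>hypercube N. K x z * L z y) * v y)"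
    unfolding sum_distrib_left sum_distrib_right mult.assoc by (rule sum.swap)
  then show "(kern N K \<circ> kern N L) v x = kern N (\<lambda>x y. \<Sum>z\<in>hypercube N. K x z * L z y) v x"
    by (simp add: kern_apply kern_Vsp)
qed

lemma kern_add: "kern N K + kern N L = kern N (\<lambda>x y. K x y + L x y)"
  by (rule ext, rule ext) (simp add: kern_apply plus_fun_def algebra_simps sum.distrib)

lemma escale_kern: "escale c (kern N K) = kern N (\<lambda>x y. c * K x y)"
  by (rule ext, rule ext) (simp add: kern_apply escale_def vscale_def sum_distrib_left mult.assoc)

lemma sum_kern: "(\<Sum>a\<in>A. kern N (K a)) = kern N (\<lambda>x y. \<Sum>a\<in>A. K a x y)"
proof (rule ext, rule ext)
  fix v x
  have "(\<Sum>a\<in>A. \<Sum>y\<in>hypercube N. K a x y * v y) = (\<Sum>y\<in>hypercube N. (\<Sum>a\<in>A. K a x y) * v y)"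
    by (subst sum.swap) (simp add: sum_distrib_right)
  then show "(\<Sum>a\<in>A. kern N (K a)) v x = kern N (\<lambda>x y. \<Sum>a\<in>A. K a x y) v x"
    by (auto simp: sum_fun_apply kern_apply)
qed

lemma kern_in_End_V: "kern N K \<in> End_V N"
proof -
  have "kern N K (v + w) = kern N K v + kern N K w" if "v \<in> Vsp N" "w \<in> Vsp N" for v w
  proof -
    have "v + w \<in> Vsp N" using that by (simp add: Vsp_def)
    with that show ?thesis
      by (intro ext) (simp add: kern_apply algebra_simps sum.distrib)
  qed
  moreover have "kern N K (vscale c v) = vscale c (kern N K v)" if "v \<in> Vsp N" for c v
  proof -
    have "vscale c v \<in> Vsp N" using that by (simp add: Vsp_def vscale_def)
    with that show ?thesis
      by (intro ext) (simp add: kern_apply vscale_def sum_distrib_left mult_ac)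
  qed
  moreover have "kern N K v = 0" if "v \<notin> Vsp N" for v
    using that by (intro ext) (simp add: kern_apply)
  ultimately show ?thesis
    by (simp add: End_V_def kern_Vsp)
qed

lemma id_V_kern: "id_V N = kern N (\<lambda>x y. of_bool (x = y))"
  unfolding id_V_def by (rule lin_ext_eq_kern) (auto simp: basis_vec_def)

lemma elem_endo_kern:
  assumes "a \<in> hypercube N"
  shows "elem_endo N a b = kern N (\<lambda>x y. of_bool (x = a \<and> y = b))"
  unfolding elem_endo_def using assms by (intro lin_ext_eq_kern) (auto simp: basis_vec_def)


section \<open>Distances in the hypercube\<close>

definition hamming :: "nat \<Rightarrow> vertex \<Rightarrow> vertex \<Rightarrow> nat" where
  "hamming N x y = card {k. k < N \<and> x k \<noteq> y k}"

definition flip :: "nat \<Rightarrow> vertex \<Rightarrow> vertex" where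
  "flip k x = x(k := - x k)"

lemma hypercube_nth: "x \<in> hypercube N \<Longrightarrow> k < N \<Longrightarrow> x k = 1 \<or> x k = -1"
  by (force simp: hypercube_def PiE_iff)

lemma hypercube_neq: "x \<in> hypercube N \<Longrightarrow> y \<in> hypercube N \<Longrightarrow> k < N \<Longrightarrow> x k \<noteq> y k \<longleftrightarrow> x k = - y k"
  using hypercube_nth[of x N k] hypercube_nth[of y N k] by auto

lemma hypercube_eqI:
  "x \<in> hypercube N \<Longrightarrow> y \<in> hypercube N \<Longrightarrow> (\<And>k. k < N \<Longrightarrow> x k = y k) \<Longrightarrow> x = y"
  unfolding hypercube_def by (rule PiE_ext) auto

lemma flip_in_hypercube: "x \<in> hypercube N \<Longrightarrow> k < N \<Longrightarrow> flip k x \<in> hypercube N"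
  by (auto simp: hypercube_def flip_def PiE_iff extensional_def)

lemma hamming_sym: "hamming N x y = hamming N y x"
  by (simp add: hamming_def eq_commute)

lemma hamming_triangle: "hamming N x z \<le> hamming N x y + hamming N y z"
proof -
  have "hamming N x z \<le> card ({k. k < N \<and> x k \<noteq> y k} \<union> {k. k < N \<and> y k \<noteq> z k})"
    unfolding hamming_def by (rule card_mono) auto
  also have "\<dots> \<le> hamming N x y + hamming N y z"
    unfolding hamming_def by (rule card_Un_le)
  finally show ?thesis .
qed

lemma hamming_0_iff: "x \<in> hypercube N \<Longrightarrow> y \<in> hypercube N \<Longrightarrow> hamming N x y = 0 \<longleftrightarrow> x = y"
  by (auto simp: hamming_def intro: hypercube_eqI)

lemma hamming_le: "hamming N x y \<le> N"
proof -
  have "hamming N x y \<le> card {..<N}"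
    unfolding hamming_def by (rule card_mono) auto
  then show ?thesis by simp
qed

text \<open>Entries are 1 or -1, so a flip at \<open>k\<close> turns agreement into difference and
  conversely. In the second case the distance is positive and the truncated subtraction is
  exact.\<close>

lemma hamming_flip:
  assumes "x \<in> hypercube N" "y \<in> hypercube N" "k < N"
  shows "hamming N (flip k x) y = (if x k = y k then hamming N x y + 1 else hamming N x y - 1)"
proof -
  have k: "flip k x k = y k \<longleftrightarrow> x k \<noteq> y k"
    using hypercube_nth[OF assms(1,3)] hypercube_nth[OF assms(2,3)] by (auto simp: flip_def)
  show ?thesis
  proof (cases "x k = y k")
    case True
    then have "{l. l < N \<and> flip k x l \<noteq> y l} = insert k {l. l < N \<and> x l \<noteq> y l}"
      using k assms by (auto simp: flip_def)
    then show ?thesis using True by (simp add: hamming_def)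
  next
    case False
    then have "{l. l < N \<and> flip k x l \<noteq> y l} = {l. l < N \<and> x l \<noteq> y l} - {k}"
      using k assms by (auto simp: flip_def)
    then show ?thesis using False assms by (simp add: hamming_def)
  qed
qed

lemma neighbours_eq:
  assumes "x \<in> hypercube N"
  shows "{y \<in> hypercube N. hamming N x y = 1} = (\<lambda>k. flip k x) ` {..<N}"
proof (intro equalityI subsetI)
  fix y assume "y \<in> {y \<in> hypercube N. hamming N x y = 1}"
  then have y: "y \<in> hypercube N" "card {k. k < N \<and> x k \<noteq> y k} = 1" by (auto simp: hamming_def)
  then obtain k where k: "{k. k < N \<and> x k \<noteq> y k} = {k}" by (auto simp: card_1_singleton_iff)
  then have "k < N" "x k \<noteq> y k" and "\<And>l. l < N \<Longrightarrow> l \<noteq> k \<Longrightarrow> x l = y l" by auto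
  then have "y = flip k x"
    using assms y
    by (intro hypercube_eqI[of _ N] flip_in_hypercube) (auto simp: flip_def hypercube_neq)
  with \<open>k < N\<close> show "y \<in> (\<lambda>k. flip k x) ` {..<N}" by blast
next
  fix y assume "y \<in> (\<lambda>k. flip k x) ` {..<N}"
  then obtain k where k: "k < N" "y = flip k x" by auto
  then show "y \<in> {y \<in> hypercube N. hamming N x y = 1}"
    using assms hamming_flip[OF assms assms k(1)] hamming_0_iff[OF assms assms]
    by (simp add: flip_in_hypercube hamming_sym)
qed

text \<open>Distinct coordinates give distinct neighbours because no entry is 0. Sums over
  coordinates serve both the distance recursion and the eigenvalues.\<close>

lemma sum_neighbours:
  assumes "x \<in> hypercube N"
  shows "(\<Sum>y | y \<in> hypercube N \<and> hamming N x y = 1. f y) = (\<Sum>k<N. f (flip k x))"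
proof -
  have "inj_on (\<lambda>k. flip k x) {..<N}"
  proof (rule inj_onI)
    fix k l assume "k \<in> {..<N}" "l \<in> {..<N}" "flip k x = flip l x"
    then show "k = l"
      using hypercube_nth[OF assms, of k] by (auto simp: flip_def fun_eq_iff split: if_splits)
  qed
  then show ?thesis
    unfolding neighbours_eq[OF assms] by (simp add: sum.reindex)
qed

lemma hc_edges_iff: "(x, y) \<in> hc_edges N \<longleftrightarrow> x \<in> hypercube N \<and> y \<in> hypercube N \<and> hamming N x y = 1"
  by (simp add: hc_edges_def hamming_def)

lemma walk_imp_hamming_le:
  assumes "(x, y) \<in> hc_edges N ^^ n" "x \<in> hypercube N"
  shows "hamming N x y \<le> n"
  using assms
proof (induction n arbitrary: y)
  case 0
  then show ?case by (simp add: hamming_def)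
next
  case (Suc n)
  then obtain z where "(x, z) \<in> hc_edges N ^^ n" "(z, y) \<in> hc_edges N" by auto
  with Suc show ?case
    using hamming_triangle[of N x y z] by (fastforce simp: hc_edges_iff)
qed

text \<open>The walk corrects the differing coordinates one after another. The induction varies the
  starting vertex, so the new edge is put in front.\<close>

lemma hamming_walk:
  assumes "x \<in> hypercube N" "y \<in> hypercube N"
  shows "(x, y) \<in> hc_edges N ^^ hamming N x y"
  using assms
proof (induction "hamming N x y" arbitrary: x)
  case 0
  then show ?case using hamming_0_iff[of x N y] by simp
next
  case (Suc n)
  then have "{k. k < N \<and> x k \<noteq> y k} \<noteq> {}" by (metis card.empty hamming_def nat.distinct(1))
  then obtain k where k: "k < N" "x k \<noteq> y k" by auto
  have d: "hamming N (flip k x) y = n" using hamming_flip[OF Suc.prems k(1)] k Suc(2) by simp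
  then have "(flip k x, y) \<in> hc_edges N ^^ n"
    using Suc(1)[of "flip k x"] flip_in_hypercube[OF Suc.prems(1) k(1)] Suc.prems by simp
  moreover have "(x, flip k x) \<in> hc_edges N"
    using neighbours_eq[OF Suc.prems(1)] k Suc.prems by (auto simp: hc_edges_iff)
  ultimately show ?case
    unfolding Suc(2)[symmetric] by (rule relpow_Suc_I2[rotated])
qed

text \<open>Each edge changes one coordinate, so no walk is shorter than the number of differing
  coordinates; \<open>hamming_walk\<close> attains this bound.\<close>

lemma hc_dist_eq_hamming:
  "x \<in> hypercube N \<Longrightarrow> y \<in> hypercube N \<Longrightarrow> hc_dist N x y = hamming N x y"
  unfolding hc_dist_def by (rule Least_equality) (auto intro: hamming_walk walk_imp_hamming_le)

lemma A_dist_kern: "A_dist N h = kern N (\<lambda>x y. of_bool (hamming N x y = h))"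
  unfolding A_dist_def
proof (rule lin_ext_eq_kern)
  fix x y assume y: "y \<in> hypercube N"
  have *: "(\<Sum>\<xi>\<in>sphere_at N h y. basis_vec \<xi>) x = of_bool (x \<in> sphere_at N h y)"
    by (auto simp: sum_fun_apply basis_vec_def sphere_at_def)
  show "x \<in> hypercube N \<Longrightarrow> (\<Sum>\<xi>\<in>sphere_at N h y. basis_vec \<xi>) x = of_bool (hamming N x y = h)"
    unfolding * using y by (simp add: sphere_at_def hc_dist_eq_hamming hamming_sym)
  show "x \<notin> hypercube N \<Longrightarrow> (\<Sum>\<xi>\<in>sphere_at N h y. basis_vec \<xi>) x = 0"
    unfolding * by (simp add: sphere_at_def)
qed

lemma A_adj_eq_A_dist: "A_adj N = A_dist N 1"
proof -
  have "{\<xi>. (x, \<xi>) \<in> hc_edges N} = sphere_at N 1 x" if "x \<in> hypercube N" for x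
    using that by (auto simp: hc_edges_iff sphere_at_def hc_dist_eq_hamming)
  then show ?thesis
    unfolding A_adj_def A_dist_def
    by (intro ext) (auto simp: lin_ext_apply intro!: sum.cong)
qed

lemma A_dual_kern:
  assumes "\<kappa> \<in> hypercube N"
  shows "A_dual N \<kappa> = kern N (\<lambda>x y. of_bool (x = y) * theta N (hamming N y \<kappa>))"
  unfolding A_dual_def
  by (rule lin_ext_eq_kern) (auto simp: vscale_def basis_vec_def hc_dist_eq_hamming assms)

lemma E_dual_kern:
  assumes "\<kappa> \<in> hypercube N"
  shows "E_dual N \<kappa> i = kern N (\<lambda>x y. of_bool (x = y) * of_bool (hamming N y \<kappa> = i))"
  unfolding E_dual_def
  by (rule lin_ext_eq_kern) (auto simp: basis_vec_def hc_dist_eq_hamming assms)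


section \<open>Elements of the subconstituent algebra\<close>

lemma kern_diag_comp:
  "kern N (\<lambda>x y. of_bool (x = y) * f y) \<circ> kern N K = kern N (\<lambda>x y. f x * K x y)"
  unfolding kern_comp
  by (rule kern_cong) (simp add: of_bool_def if_distribR if_distrib cong: if_cong)

lemma kern_comp_diag:
  "kern N K \<circ> kern N (\<lambda>x y. of_bool (x = y) * f y) = kern N (\<lambda>x y. K x y * f y)"
  unfolding kern_comp
  by (rule kern_cong) (simp add: of_bool_def if_distribR if_distrib cong: if_cong)

text \<open>One factor \<open>A_dual - theta l\<close> for each \<open>l \<in> L\<close>: a
  polynomial in the dual adjacency map with prescribed roots, as interpolation requires.\<close>

lemma diag_prod_in_subconst:
  assumes "\<kappa> \<in> hypercube N" "finite L"
  shows "kern N (\<lambda>x y. of_bool (x = y) * (\<Prod>l\<in>L. theta N (hamming N y \<kappa>) - theta N l))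
    \<in> subconst_alg N \<kappa>"
  using assms(2)
proof (induction L rule: finite_induct)
  case empty
  then show ?case using subconst_alg.one[of N \<kappa>] by (simp add: id_V_kern)
next
  case (insert l L)
  have "A_dual N \<kappa> + escale (- theta N l) (id_V N) \<in> subconst_alg N \<kappa>"
    by (intro subconst_alg.intros)
  also have "A_dual N \<kappa> + escale (- theta N l) (id_V N)
     = kern N (\<lambda>x y. of_bool (x = y) * (theta N (hamming N y \<kappa>) - theta N l))"
    by (simp add: A_dual_kern[OF assms(1)] id_V_kern escale_kern kern_add algebra_simps)
  finally have "kern N (\<lambda>x y. of_bool (x = y) * (theta N (hamming N y \<kappa>) - theta N l))
    \<circ> kern N (\<lambda>x y. of_bool (x = y) * (\<Prod>l\<in>L. theta N (hamming N y \<kappa>) - theta N l)) \<in> subconst_alg N \<kappa>"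
    using insert.IH by (rule subconst_alg.comp)
  also have "kern N (\<lambda>x y. of_bool (x = y) * (theta N (hamming N y \<kappa>) - theta N l))
    \<circ> kern N (\<lambda>x y. of_bool (x = y) * (\<Prod>l\<in>L. theta N (hamming N y \<kappa>) - theta N l))
    = kern N (\<lambda>x y. of_bool (x = y) * (\<Prod>l\<in>insert l L. theta N (hamming N y \<kappa>) - theta N l))"
    unfolding kern_diag_comp using insert.hyps by (intro kern_cong) (auto simp: mult_ac)
  finally show ?case .
qed

lemma theta_eq_iff: "theta N i = theta N j \<longleftrightarrow> i = j"
  by (simp add: theta_def)

lemma zero_in_subconst: "0 \<in> subconst_alg N \<kappa>"
proof -
  have "escale 0 (id_V N) \<in> subconst_alg N \<kappa>" by (intro subconst_alg.intros)
  also have "escale 0 (id_V N) = 0" by (intro ext) (simp add: escale_def vscale_def)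
  finally show ?thesis .
qed

lemma sum_in_subconst:
  "(\<And>a. a \<in> A \<Longrightarrow> F a \<in> subconst_alg N \<kappa>) \<Longrightarrow> (\<Sum>a\<in>A. F a) \<in> subconst_alg N \<kappa>"
  by (induction A rule: infinite_finite_induct) (auto intro: zero_in_subconst subconst_alg.add)

text \<open>Lagrange interpolation in the eigenvalues of the dual adjacency map.\<close>

lemma E_dual_in_subconst:
  assumes "\<kappa> \<in> hypercube N"
  shows "E_dual N \<kappa> i \<in> subconst_alg N \<kappa>"
proof -
  let ?L = "{..N} - {i}"
  let ?c = "\<Prod>l\<in>?L. theta N i - theta N l"
  have c: "?c \<noteq> 0" by (auto simp: theta_eq_iff)
  \<comment> \<open>A distance other than \<open>i\<close> is at most \<open>N\<close>, hence lies
    in \<open>?L\<close> and makes a factor vanish.\<close>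
  have "(\<Prod>l\<in>?L. theta N (hamming N y \<kappa>) - theta N l) = ?c * of_bool (hamming N y \<kappa> = i)" for y
    using hamming_le[of N y \<kappa>] by (auto intro!: prod_zero)
  then have "E_dual N \<kappa> i = escale (1 / ?c)
     (kern N (\<lambda>x y. of_bool (x = y) * (\<Prod>l\<in>?L. theta N (hamming N y \<kappa>) - theta N l)))"
    using c unfolding E_dual_kern[OF assms] escale_kern by (intro kern_cong) auto
  moreover have "\<dots> \<in> subconst_alg N \<kappa>"
    by (intro subconst_alg.scale diag_prod_in_subconst assms) auto
  ultimately show ?thesis by simp
qed

text \<open>Flipping a coordinate where \<open>x\<close> and \<open>y\<close> differ lowers the
  distance by 1, any other flip raises it by 1. Distance \<open>h + 1\<close> is thus reached from
  \<open>h + 2\<close> in \<open>h + 2\<close> ways and from \<open>h\<close> in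
  \<open>N - h\<close> ways.\<close>

lemma A_dist_recursion_entry:
  assumes "x \<in> hypercube N" "y \<in> hypercube N"
  shows "(\<Sum>z\<in>hypercube N. of_bool (hamming N x z = 1) * of_bool (hamming N z y = Suc h))
    = (of_nat (h + 2) * of_bool (hamming N x y = h + 2)
       + (of_nat N - of_nat h) * of_bool (hamming N x y = h) :: complex)"
proof -
  let ?d = "hamming N x y"
  have "(\<Sum>z\<in>hypercube N. of_bool (hamming N x z = 1) * of_bool (hamming N z y = Suc h) :: complex)
    = (\<Sum>z | z \<in> hypercube N \<and> hamming N x z = 1. of_bool (hamming N z y = Suc h))"
    by (intro sum.mono_neutral_cong_right) auto
  also have "\<dots> = (\<Sum>k<N. of_bool (hamming N (flip k x) y = Suc h))"
    by (rule sum_neighbours[OF assms(1)])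
  also have "\<dots> = (\<Sum>k<N. if x k \<noteq> y k then of_bool (?d = h + 2) else of_bool (?d = h))"
    by (intro sum.cong) (auto simp: hamming_flip[OF assms])
  also have "\<dots> = of_nat (card {k. k < N \<and> x k \<noteq> y k}) * of_bool (?d = h + 2)
     + of_nat (card {k. k < N \<and> x k = y k}) * of_bool (?d = h)"
    by (simp add: sum.If_cases Int_def)
  also have "card {k. k < N \<and> x k = y k} = N - ?d"
  proof -
    have "{k. k < N \<and> x k = y k} = {..<N} - {k. k < N \<and> x k \<noteq> y k}" by auto
    then show ?thesis by (simp add: hamming_def card_Diff_subset subset_iff)
  qed
  finally show ?thesis
    using hamming_le[of N x y] by (auto simp: hamming_def[symmetric] of_nat_diff)
qed

text \<open>The three-term recursion is solved for \<open>A_dist N (h + 2)\<close>, whose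
  coefficient \<open>h + 2\<close> is nonzero; distances 0 and 1 give the identity and the adjacency
  map.\<close>

lemma A_dist_in_subconst: "A_dist N h \<in> subconst_alg N \<kappa>"
proof (induction h rule: induct_nat_012)
  case 0
  have "A_dist N 0 = id_V N"
    unfolding A_dist_kern id_V_kern by (rule kern_cong) (simp add: hamming_0_iff)
  then show ?case by (simp add: subconst_alg.one)
next
  case 1
  then show ?case using A_adj_eq_A_dist[of N] subconst_alg.adj[of N \<kappa>] by simp
next
  case (ge2 h)
  have "A_dist N (Suc (Suc h)) = escale (1 / of_nat (h + 2))
      ((A_adj N \<circ> A_dist N (Suc h)) + escale (of_nat h - of_nat N) (A_dist N h))"
    unfolding A_adj_eq_A_dist A_dist_kern kern_comp escale_kern kern_add
    by (intro kern_cong, simp only: A_dist_recursion_entry)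
      (simp add: field_simps del: of_nat_Suc of_nat_add)
  with ge2 show ?case by (metis subconst_alg.intros)
qed


section \<open>Characters and the primitive idempotents\<close>

definition chi :: "nat set \<Rightarrow> vertex \<Rightarrow> complex" where
  "chi S x = (\<Prod>k\<in>S. of_int (x k))"

lemma chi_eq_prod_lessThan: "S \<subseteq> {..<N} \<Longrightarrow> chi S x = (\<Prod>k<N. if k \<in> S then of_int (x k) else 1)"
  unfolding chi_def by (subst prod.inter_restrict[symmetric]) (auto simp: Int_absorb1)

text \<open>Coordinates common to \<open>S\<close> and \<open>T\<close> contribute squares of 1 or
  -1, so only the symmetric difference survives.\<close>

lemma chi_mult_chi:
  assumes "S \<subseteq> {..<N}" "T \<subseteq> {..<N}" "x \<in> hypercube N"
  shows "chi S x * chi T x = chi (S - T \<union> (T - S)) x"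
proof -
  have "S - T \<union> (T - S) \<subseteq> {..<N}" using assms by auto
  then show ?thesis
    using hypercube_nth[OF assms(3)]
    by (simp only: chi_eq_prod_lessThan[of _ N] assms(1,2) prod.distrib[symmetric])
      (intro prod.cong refl, force)
qed

text \<open>The sum factors over the coordinates: each one in \<open>S\<close> contributes
  \<open>1 + (-1) = 0\<close>, each other one 2.\<close>

lemma sum_hypercube_chi:
  assumes "S \<subseteq> {..<N}"
  shows "(\<Sum>x\<in>hypercube N. chi S x) = 2 ^ N * of_bool (S = {})"
proof -
  have "(\<Sum>x\<in>hypercube N. chi S x)
    = (\<Sum>x\<in>{..<N} \<rightarrow>\<^sub>E {1, -1}. \<Prod>k<N. if k \<in> S then of_int (x k) else 1)"
    by (simp add: hypercube_def chi_eq_prod_lessThan[OF assms])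
  also have "\<dots> = (\<Prod>k<N. \<Sum>c\<in>{1, -1 :: int}. if k \<in> S then of_int c else 1)"
    by (rule prod_sum_PiE[symmetric]) auto
  also have "\<dots> = (\<Prod>k<N. if k \<in> S then 0 else 2)"
    by (intro prod.cong) auto
  also have "\<dots> = 2 ^ N * of_bool (S = {})"
    using assms by (cases "S = {}") (auto intro!: prod_zero)
  finally show ?thesis .
qed

text \<open>The product is the character of the symmetric difference of all three sets, and its sum
  vanishes unless that set is empty.\<close>

lemma sum_hypercube_chi3:
  assumes "S \<subseteq> {..<N}" "R \<subseteq> {..<N}" "T \<subseteq> {..<N}"
  shows "(\<Sum>x\<in>hypercube N. chi S x * chi R x * chi T x) = 2 ^ N * of_bool (R = S - T \<union> (T - S))"
proof -
  let ?D = "S - T \<union> (T - S)"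
  have D: "?D \<subseteq> {..<N}" "?D - R \<union> (R - ?D) \<subseteq> {..<N}" using assms by auto
  have "chi S x * chi R x * chi T x = chi (?D - R \<union> (R - ?D)) x" if "x \<in> hypercube N" for x
  proof -
    have "chi S x * chi R x * chi T x = (chi S x * chi T x) * chi R x" by simp
    then show ?thesis by (simp only: chi_mult_chi[of _ N] assms that D)
  qed
  then have "(\<Sum>x\<in>hypercube N. chi S x * chi R x * chi T x)
      = 2 ^ N * of_bool (?D - R \<union> (R - ?D) = {})"
    by (simp only: sum_hypercube_chi D cong: sum.cong)
  moreover have "?D - R \<union> (R - ?D) = {} \<longleftrightarrow> R = ?D" by blast
  ultimately show ?thesis by simp
qed

text \<open>The sum over subsets is the expanded product of the factors
  \<open>x k * y k + 1\<close>, which are 2 where \<open>x\<close> and \<open>y\<close> agree and 0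
  elsewhere.\<close>

lemma sum_Pow_chi_chi:
  assumes "x \<in> hypercube N" "y \<in> hypercube N"
  shows "(\<Sum>S\<in>Pow {..<N}. chi S x * chi S y) = 2 ^ N * of_bool (x = y)"
proof -
  have "(\<Sum>S\<in>Pow {..<N}. chi S x * chi S y)
    = (\<Sum>S\<in>Pow {..<N}. (\<Prod>k\<in>S. of_int (x k) * of_int (y k)) * (\<Prod>k\<in>{..<N} - S. 1))"
    by (simp add: chi_def prod.distrib)
  also have "\<dots> = (\<Prod>k<N. of_int (x k) * of_int (y k) + 1)"
    by (rule prod_add[symmetric]) simp
  also have "\<dots> = (\<Prod>k<N. if x k = y k then 2 else 0)"
    using hypercube_nth[OF assms(1)] hypercube_nth[OF assms(2)] by (intro prod.cong) force+
  also have "\<dots> = 2 ^ N * of_bool (x = y)"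
  proof (cases "x = y")
    case False
    then obtain k where "k < N" "x k \<noteq> y k" using hypercube_eqI[OF assms] by blast
    with False show ?thesis by (auto intro!: prod_zero)
  qed simp
  finally show ?thesis .
qed

section \<open>Spectral decomposition of the adjacency map\<close>

lemma A_chi:
  assumes "S \<subseteq> {..<N}" "x \<in> hypercube N"
  shows "(\<Sum>y\<in>hypercube N. of_bool (hamming N x y = 1) * chi S y) = theta N (card S) * chi S x"
proof -
  have fin: "finite S" using assms(1) finite_subset by blast
  \<comment> \<open>Passing to a neighbour negates \<open>chi S\<close> exactly when the flipped
    coordinate lies in \<open>S\<close>, whence the eigenvalue
    \<open>(N - card S) - card S\<close>.\<close>
  have flip: "chi S (flip k x) = (if k \<in> S then - chi S x else chi S x)" for k
  proof (cases "k \<in> S")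
    case True
    have "(\<Prod>l\<in>S - {k}. of_int (flip k x l)) = (\<Prod>l\<in>S - {k}. of_int (x l) :: complex)"
      by (intro prod.cong) (auto simp: flip_def)
    with True show ?thesis
      using fin by (simp add: chi_def prod.remove[of S k] flip_def)
  next
    case False
    then show ?thesis by (auto simp: chi_def flip_def intro!: prod.cong)
  qed
  have "(\<Sum>y\<in>hypercube N. of_bool (hamming N x y = 1) * chi S y)
    = (\<Sum>y | y \<in> hypercube N \<and> hamming N x y = 1. chi S y)"
    by (intro sum.mono_neutral_cong_right) auto
  also have "\<dots> = (\<Sum>k<N. if k \<in> S then - chi S x else chi S x)"
    by (simp only: sum_neighbours[OF assms(2)] flip)
  also have "\<dots> = of_nat (card ({..<N} - S)) * chi S x - of_nat (card S) * chi S x"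
    using assms(1) by (simp add: sum.If_cases Int_absorb1 Diff_eq)
  also have "\<dots> = theta N (card S) * chi S x"
    using card_mono[OF _ assms(1)] fin assms(1)
    by (simp add: card_Diff_subset of_nat_diff theta_def algebra_simps)
  finally show ?thesis .
qed

text \<open>Matrix of the orthogonal projection onto the span of the characters \<open>chi S\<close>
  with \<open>card S = i\<close>. Characters have squared norm \<open>2 ^ N\<close>, whence the
  factor.\<close>

definition spec_proj :: "nat \<Rightarrow> nat \<Rightarrow> vertex \<Rightarrow> vertex \<Rightarrow> complex" where
  "spec_proj N i x y = (1 / 2 ^ N) * (\<Sum>S | S \<subseteq> {..<N} \<and> card S = i. chi S x * chi S y)"

lemma spec_proj_sym: "spec_proj N i x y = spec_proj N i y x"
  by (simp add: spec_proj_def mult.commute)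

lemma A_spec_proj:
  assumes "x \<in> hypercube N"
  shows "(\<Sum>z\<in>hypercube N. of_bool (hamming N x z = 1) * spec_proj N i z y)
    = theta N i * spec_proj N i x y"
proof -
  have "(\<Sum>z\<in>hypercube N. of_bool (hamming N x z = 1) * spec_proj N i z y)
    = (1 / 2 ^ N) * (\<Sum>z\<in>hypercube N. \<Sum>S | S \<subseteq> {..<N} \<and> card S = i.
          of_bool (hamming N x z = 1) * chi S z * chi S y)"
    unfolding spec_proj_def sum_distrib_left by (simp add: mult_ac)
  also have "\<dots> = (1 / 2 ^ N) * (\<Sum>S | S \<subseteq> {..<N} \<and> card S = i.
       (\<Sum>z\<in>hypercube N. of_bool (hamming N x z = 1) * chi S z) * chi S y)"
    unfolding sum_distrib_right by (subst sum.swap) (rule refl)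
  also have "\<dots> = theta N i * spec_proj N i x y"
    unfolding spec_proj_def sum_distrib_left
    by (intro sum.cong refl) (simp only: mem_Collect_eq A_chi assms, simp add: mult_ac)
  finally show ?thesis .
qed

lemma A_adj_spec_proj:
  "A_adj N \<circ> kern N (spec_proj N i) = escale (theta N i) (kern N (spec_proj N i))"
  unfolding A_adj_eq_A_dist A_dist_kern kern_comp escale_kern
  by (rule kern_cong) (rule A_spec_proj)

text \<open>Transpose of the preceding identity, both matrices being symmetric. It controls the
  projections on eigenvectors not yet known to be combinations of characters.\<close>

lemma spec_proj_A_adj:
  "kern N (spec_proj N i) \<circ> A_adj N = escale (theta N i) (kern N (spec_proj N i))"
  unfolding A_adj_eq_A_dist A_dist_kern kern_comp escale_kern
proof (rule kern_cong)
  fix x y assume "y \<in> hypercube N"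
  then show "(\<Sum>z\<in>hypercube N. spec_proj N i x z * of_bool (hamming N z y = 1))
     = theta N i * spec_proj N i x y"
    using A_spec_proj[of y N i x] by (simp only: hamming_sym spec_proj_sym[of N i x] mult.commute)
qed

text \<open>Grouping the subsets of \<open>{..<N}\<close> by size reduces this to the orthogonality
  relation \<open>sum_Pow_chi_chi\<close>.\<close>

lemma sum_spec_proj: "(\<Sum>i\<le>N. kern N (spec_proj N i)) = id_V N"
  unfolding sum_kern id_V_kern
proof (rule kern_cong)
  fix x y assume xy: "x \<in> hypercube N" "y \<in> hypercube N"
  have "card S \<le> N" if "S \<subseteq> {..<N}" for S
    using card_mono[OF _ that] by simp
  then have "(\<Sum>i\<le>N. \<Sum>S | S \<in> Pow {..<N} \<and> card S = i. chi S x * chi S y)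
    = (\<Sum>S\<in>Pow {..<N}. chi S x * chi S y)"
    by (intro sum.group) auto
  then show "(\<Sum>i\<le>N. spec_proj N i x y) = of_bool (x = y)"
    by (simp add: spec_proj_def sum_distrib_left[symmetric] sum_Pow_chi_chi[OF xy]
        flip: sum_divide_distrib)
qed

lemma sum_spec_proj_apply: "v \<in> Vsp N \<Longrightarrow> (\<Sum>i\<le>N. kern N (spec_proj N i) v) = v"
proof -
  assume v: "v \<in> Vsp N"
  have "(\<Sum>i\<le>N. kern N (spec_proj N i) v) = id_V N v"
    by (simp add: sum_spec_proj[symmetric] sum_fun_apply)
  also have "\<dots> = v"
    using v by (intro ext) (auto simp: id_V_kern kern_apply Vsp_def)
  finally show ?thesis .
qed

lemma spec_proj_in_eigenspace:
  "kern N (spec_proj N i) v \<in> eigenspace N (A_adj N) (theta N i)"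
  using fun_cong[OF A_adj_spec_proj[of N i], of v] by (simp add: eigenspace_def kern_Vsp escale_def)

text \<open>\<open>F\<close> is known to be additive on \<open>V\<close> only, so the induction also
  carries the membership of the partial sums in \<open>V\<close>.\<close>

lemma End_V_apply_sum:
  assumes F: "F \<in> End_V N" and "\<And>a. a \<in> A \<Longrightarrow> v a \<in> Vsp N"
  shows "F (\<Sum>a\<in>A. v a) = (\<Sum>a\<in>A. F (v a))"
proof -
  have zero: "0 \<in> Vsp N" by (simp add: Vsp_def)
  have F0: "F 0 = 0"
  proof -
    have "F (vscale 0 0) = vscale 0 (F 0)" using F zero unfolding End_V_def by blast
    then show ?thesis by (simp add: vscale_def zero_fun_def)
  qed
  have "(\<Sum>a\<in>A. v a) \<in> Vsp N \<and> F (\<Sum>a\<in>A. v a) = (\<Sum>a\<in>A. F (v a))"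
    using assms(2)
  proof (induction A rule: infinite_finite_induct)
    case (insert a A)
    then have IH: "(\<Sum>a\<in>A. v a) \<in> Vsp N" "F (\<Sum>a\<in>A. v a) = (\<Sum>a\<in>A. F (v a))" by auto
    with insert have "F (v a + (\<Sum>a\<in>A. v a)) = F (v a) + F (\<Sum>a\<in>A. v a)"
      using F unfolding End_V_def by blast
    moreover have "v a + (\<Sum>a\<in>A. v a) \<in> Vsp N"
      using insert by (simp add: Vsp_def)
    ultimately show ?case
      unfolding sum.insert[OF insert.hyps] unfolding IH(2) by blast
  qed (simp_all add: F0 zero)
  then show ?thesis ..
qed

text \<open>With P_l for the projection of index \<open>l\<close>, evaluating P_l on the image of
  \<open>v\<close> under the adjacency map in two ways shows that P_l annihilates \<open>v\<close>
  for \<open>l \<noteq> j\<close>. The projections sum to the identity and \<open>j \<le> N\<close>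
  is among the indices, so P_j fixes \<open>v\<close>.\<close>

lemma spec_proj_eigenvector:
  assumes v: "v \<in> eigenspace N (A_adj N) (theta N j)" and "j \<le> N"
  shows "kern N (spec_proj N i) v = (if i = j then v else 0)"
proof -
  have vV: "v \<in> Vsp N" and Av: "A_adj N v = vscale (theta N j) v"
    using v by (auto simp: eigenspace_def)
  have neq: "kern N (spec_proj N l) v = 0" if "l \<noteq> j" for l
  proof
    fix x
    have "kern N (spec_proj N l) (vscale (theta N j) v) = vscale (theta N j) (kern N (spec_proj N l) v)"
      using kern_in_End_V vV unfolding End_V_def by blast
    then have "vscale (theta N l) (kern N (spec_proj N l) v) = vscale (theta N j) (kern N (spec_proj N l) v)"
      using fun_cong[OF spec_proj_A_adj[of N l], of v] by (simp add: Av escale_def)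
    then have "theta N l * kern N (spec_proj N l) v x = theta N j * kern N (spec_proj N l) v x"
      unfolding vscale_def by (rule fun_cong)
    then show "kern N (spec_proj N l) v x = 0 x"
      using that by (simp add: theta_eq_iff)
  qed
  have "v = (\<Sum>l\<le>N. kern N (spec_proj N l) v)" by (simp add: sum_spec_proj_apply vV)
  also have "\<dots> = (\<Sum>l\<le>N. if l = j then kern N (spec_proj N j) v else 0)"
    by (intro sum.cong) (auto simp: neq)
  finally have "v = kern N (spec_proj N j) v" using \<open>j \<le> N\<close> by simp
  with neq show ?thesis by auto
qed

text \<open>Uniqueness holds because every vector of \<open>V\<close> is the sum of its spectral
  projections, which are eigenvectors on which the description prescribes the values.\<close>

lemma E_idem_kern:
  assumes "i \<le> N"
  shows "E_idem N i = kern N (spec_proj N i)"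
  unfolding E_idem_def
proof (rule the_equality)
  show "kern N (spec_proj N i) \<in> End_V N
     \<and> (\<forall>v\<in>eigenspace N (A_adj N) (theta N i). kern N (spec_proj N i) v = v)
     \<and> (\<forall>j\<le>N. j \<noteq> i \<longrightarrow> (\<forall>v\<in>eigenspace N (A_adj N) (theta N j). kern N (spec_proj N i) v = 0))"
    using assms by (auto simp: kern_in_End_V spec_proj_eigenvector)
next
  fix F
  assume F: "F \<in> End_V N
     \<and> (\<forall>v\<in>eigenspace N (A_adj N) (theta N i). F v = v)
     \<and> (\<forall>j\<le>N. j \<noteq> i \<longrightarrow> (\<forall>v\<in>eigenspace N (A_adj N) (theta N j). F v = 0))"
  show "F = kern N (spec_proj N i)"
  proof
    fix v
    show "F v = kern N (spec_proj N i) v"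
    proof (cases "v \<in> Vsp N")
      case True
      have "F v = F (\<Sum>l\<le>N. kern N (spec_proj N l) v)" by (simp add: sum_spec_proj_apply True)
      also have "\<dots> = (\<Sum>l\<le>N. F (kern N (spec_proj N l) v))"
        using F by (intro End_V_apply_sum) (auto simp: kern_Vsp)
      also have "\<dots> = (\<Sum>l\<le>N. if l = i then kern N (spec_proj N i) v else 0)"
        using F spec_proj_in_eigenspace by (intro sum.cong) auto
      finally show ?thesis using assms by simp
    next
      case False
      then show ?thesis using F kern_in_End_V[of N "spec_proj N i"] by (simp add: End_V_def)
    qed
  qed
qed

lemma basis_vec_in_Vsp: "x \<in> hypercube N \<Longrightarrow> basis_vec x \<in> Vsp N"
  by (auto simp: Vsp_def basis_vec_def)

lemma A_dual_dist_kern: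
  assumes "\<kappa> \<in> hypercube N" "h \<le> N"
  shows "A_dual_dist N \<kappa> h = kern N (\<lambda>x y. of_bool (x = y) * (2 ^ N * spec_proj N h \<kappa> y))"
proof -
  have "herm N (E_idem N h (basis_vec \<kappa>)) (basis_vec y) = spec_proj N h \<kappa> y"
    if "y \<in> hypercube N" for y
  proof -
    have "herm N v (basis_vec y) = v y" for v
      using that by (simp add: herm_def basis_vec_def if_distrib cong: if_cong)
    then show ?thesis
      using that assms
      using basis_vec_in_Vsp[OF assms(1)]
      by (simp add: E_idem_kern kern_apply spec_proj_sym[of N h \<kappa>])
        (simp add: basis_vec_def if_distrib cong: if_cong)
  qed
  then show ?thesis
    unfolding A_dual_dist_def by (intro lin_ext_eq_kern) (auto simp: vscale_def basis_vec_def)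
qed

section \<open>Matrix of the product of two idempotents around a dual distance map\<close>

lemma sum_product3:
  "sum f A * (sum g B * sum k C) = (\<Sum>a\<in>A. \<Sum>b\<in>B. \<Sum>c\<in>C. f a * (g b * k c))"
  for f :: "'a \<Rightarrow> 'd::comm_semiring_0"
  by (simp only: sum_product[of g B k C] sum_product[of f A]) (simp add: sum_distrib_left)

text \<open>Orthogonality ties the set \<open>R\<close> of the middle factor to the symmetric
  difference of \<open>S\<close> and \<open>T\<close>. Of the three factors
  \<open>1 / 2 ^ N\<close>, one is cancelled by the scalar in \<open>A_dual_dist\<close> and one by
  the sum over \<open>x\<close>.\<close>

lemma idem_dual_idem_kern:
  assumes "\<kappa> \<in> hypercube N" "i \<le> N" "h \<le> N" "j \<le> N"
  shows "E_idem N i \<circ> A_dual_dist N \<kappa> h \<circ> E_idem N j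
    = kern N (\<lambda>y z. (1 / 2 ^ N) * (\<Sum>(S, T) | S \<subseteq> {..<N} \<and> T \<subseteq> {..<N} \<and> card S = i \<and> card T = j
          \<and> card (S - T \<union> (T - S)) = h.
        (chi S y * chi S \<kappa>) * (chi T z * chi T \<kappa>)))"
proof -
  let ?P = "\<lambda>i. {S. S \<subseteq> {..<N} \<and> card S = i}"
  have fin: "finite (?P i)" for i by simp
  have "(\<Sum>x\<in>hypercube N. (spec_proj N i y x * (2 ^ N * spec_proj N h \<kappa> x)) * spec_proj N j x z)
    = (1 / 2 ^ N) * (\<Sum>(S, T) | S \<subseteq> {..<N} \<and> T \<subseteq> {..<N} \<and> card S = i \<and> card T = j
          \<and> card (S - T \<union> (T - S)) = h.
        (chi S y * chi S \<kappa>) * (chi T z * chi T \<kappa>))" for y z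
  proof -
    have "(\<Sum>x\<in>hypercube N. (spec_proj N i y x * (2 ^ N * spec_proj N h \<kappa> x)) * spec_proj N j x z)
      = (\<Sum>x\<in>hypercube N. 1 / (2 ^ N * 2 ^ N) * (\<Sum>S\<in>?P i. \<Sum>T\<in>?P j. \<Sum>R\<in>?P h.
           chi S y * chi T z * chi R \<kappa> * (chi S x * chi R x * chi T x)))"
    proof (intro sum.cong refl)
      fix x
      have "spec_proj N i y x * (2 ^ N * spec_proj N h \<kappa> x) * spec_proj N j x z
        = 1 / (2 ^ N * 2 ^ N) * ((\<Sum>S\<in>?P i. chi S y * chi S x) *
           ((\<Sum>T\<in>?P j. chi T x * chi T z) * (\<Sum>R\<in>?P h. chi R \<kappa> * chi R x)))"
        by (simp add: spec_proj_def field_simps)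
      also have "\<dots> = 1 / (2 ^ N * 2 ^ N) * (\<Sum>S\<in>?P i. \<Sum>T\<in>?P j. \<Sum>R\<in>?P h.
           chi S y * chi T z * chi R \<kappa> * (chi S x * chi R x * chi T x))"
        unfolding sum_product3
        by (rule arg_cong[where f="\<lambda>t. 1 / (2 ^ N * 2 ^ N) * t"], intro sum.cong refl) (simp add: mult_ac)
      finally show "spec_proj N i y x * (2 ^ N * spec_proj N h \<kappa> x) * spec_proj N j x z
        = 1 / (2 ^ N * 2 ^ N) * (\<Sum>S\<in>?P i. \<Sum>T\<in>?P j. \<Sum>R\<in>?P h.
           chi S y * chi T z * chi R \<kappa> * (chi S x * chi R x * chi T x))" .
    qed
    also have "\<dots> = 1 / (2 ^ N * 2 ^ N) * (\<Sum>S\<in>?P i. \<Sum>T\<in>?P j. \<Sum>R\<in>?P h.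
           chi S y * chi T z * chi R \<kappa> * (\<Sum>x\<in>hypercube N. chi S x * chi R x * chi T x))"
      unfolding sum_distrib_left
      by (subst sum.swap, intro sum.cong refl, subst sum.swap, intro sum.cong refl, rule sum.swap)
    also have "\<dots> = 1 / (2 ^ N * 2 ^ N) * (\<Sum>S\<in>?P i. \<Sum>T\<in>?P j. \<Sum>R\<in>?P h.
           if R = S - T \<union> (T - S) then 2 ^ N * (chi S y * chi T z * chi (S - T \<union> (T - S)) \<kappa>) else 0)"
      by (intro arg_cong2[where f="(*)"] sum.cong refl) (auto simp: sum_hypercube_chi3)
    \<comment> \<open>A term survives the sum over \<open>R\<close> exactly when the symmetric
      difference has size \<open>h\<close>; its character at \<open>\<kappa>\<close> splits into
      those of \<open>S\<close> and \<open>T\<close>.\<close>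
    also have "\<dots> = 1 / (2 ^ N * 2 ^ N) * (\<Sum>S\<in>?P i. \<Sum>T\<in>?P j.
        if card (S - T \<union> (T - S)) = h then 2 ^ N * ((chi S y * chi S \<kappa>) * (chi T z * chi T \<kappa>)) else 0)"
      by (intro arg_cong2[where f="(*)"] sum.cong refl)
        (auto simp: chi_mult_chi[OF _ _ assms(1), symmetric])
    also have "\<dots> = (1 / 2 ^ N) * (\<Sum>S\<in>?P i. \<Sum>T\<in>?P j.
        if card (S - T \<union> (T - S)) = h then ((chi S y * chi S \<kappa>) * (chi T z * chi T \<kappa>)) else 0)"
      by (simp add: sum_distrib_left if_distrib cong: if_cong)
    also have "(\<Sum>S\<in>?P i. \<Sum>T\<in>?P j.
        if card (S - T \<union> (T - S)) = h then ((chi S y * chi S \<kappa>) * (chi T z * chi T \<kappa>)) else 0)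
      = (\<Sum>(S, T)\<in>{(S, T). S \<subseteq> {..<N} \<and> T \<subseteq> {..<N} \<and> card S = i \<and> card T = j
          \<and> card (S - T \<union> (T - S)) = h}. (chi S y * chi S \<kappa>) * (chi T z * chi T \<kappa>))"
      unfolding sum.cartesian_product
      by (rule sum.mono_neutral_cong_right) (auto split: if_splits)
    finally show ?thesis by simp
  qed
  then show ?thesis
    using assms
    by (simp add: E_idem_kern A_dual_dist_kern kern_comp_diag) (simp add: kern_comp)
qed


section \<open>Words in four letters and coefficients of dual monomials\<close>

text \<open>The letters \<open>x, y, z, w\<close> are encoded by pairs of truth values such that the change of
  variables becomes the character table \<open>letter_sign\<close> of the Klein four-group.\<close>

type_synonym letter = "bool \<times> bool"

fun unit4 :: "letter \<Rightarrow> nat \<times> nat \<times> nat \<times> nat" where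
  "unit4 (False, False) = (1, 0, 0, 0)"
| "unit4 (True, True) = (0, 1, 0, 0)"
| "unit4 (False, True) = (0, 0, 1, 0)"
| "unit4 (True, False) = (0, 0, 0, 1)"

text \<open>The first component of either letter is paired with the second of the other. This suits
  \<open>pair_word\<close>, which lists \<open>z\<close> before \<open>y\<close>, while the pair
  \<open>(S, T)\<close> has \<open>S\<close> acting on \<open>y\<close> and \<open>T\<close> on
  \<open>z\<close>.\<close>

fun letter_sign :: "letter \<Rightarrow> letter \<Rightarrow> complex" where
  "letter_sign (s, t) (c, d) = (if s \<and> d then -1 else 1) * (if t \<and> c then -1 else 1)"

definition words :: "nat \<Rightarrow> (nat \<Rightarrow> letter) set" where
  "words N = ({..<N} \<rightarrow>\<^sub>E UNIV)"

definition content :: "nat \<Rightarrow> (nat \<Rightarrow> letter) \<Rightarrow> nat \<times> nat \<times> nat \<times> nat" where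
  "content N \<alpha> = (\<Sum>k<N. unit4 (\<alpha> k))"

fun monomial4 :: "(letter \<Rightarrow> 'a::comm_monoid_mult) \<Rightarrow> nat \<times> nat \<times> nat \<times> nat \<Rightarrow> 'a" where
  "monomial4 f (r, s, t, u) =
     f (False, False) ^ r * f (True, True) ^ s * f (False, True) ^ t * f (True, False) ^ u"

fun prod_fact :: "nat \<times> nat \<times> nat \<times> nat \<Rightarrow> nat" where
  "prod_fact (r, s, t, u) = fact r * fact s * fact t * fact u"

fun exponent_of :: "letter \<Rightarrow> nat \<times> nat \<times> nat \<times> nat \<Rightarrow> nat" where
  "exponent_of (False, False) (r, s, t, u) = r"
| "exponent_of (True, True) (r, s, t, u) = s"
| "exponent_of (False, True) (r, s, t, u) = t"
| "exponent_of (True, False) (r, s, t, u) = u"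

lemma letter_sign_sym: "letter_sign a b = letter_sign b a"
  by (cases a; cases b) auto

lemma letter_cases:
  fixes l :: letter
  obtains "l = (False, False)" | "l = (True, True)" | "l = (False, True)" | "l = (True, False)"
  by (cases l) auto

lemma sum_letters:
  "(\<Sum>l\<in>(UNIV :: letter set). g l) =
     g (False, False) + g (True, True) + g (False, True) + g (True, False)"
proof -
  have UNIV_eq: "(UNIV :: letter set) = {(False, False), (True, True), (False, True), (True, False)}"
    by auto
  show ?thesis unfolding UNIV_eq by (simp add: add.assoc)
qed

lemma finite_words [simp]: "finite (words N)"
  by (simp add: words_def finite_PiE)

lemma monomial4_add: "monomial4 f (p + q) = monomial4 f p * monomial4 f q"
  by (cases p; cases q) (simp add: power_add mult_ac)

lemma monomial4_unit4: "monomial4 f (unit4 l) = f l"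
  by (cases l rule: letter_cases) simp_all

text \<open>\<open>monomial4 f\<close> turns sums of exponents into products and takes
  \<open>unit4 l\<close> to \<open>f l\<close>.\<close>

lemma prod_eq_monomial4: "(\<Prod>k<N. f (\<alpha> k)) = monomial4 f (content N \<alpha>)"
  by (induction N) (simp_all add: content_def monomial4_add monomial4_unit4 mult.commute zero_prod_def)

lemma content_in_profiles: "content N \<alpha> \<in> profiles N"
proof (induction N)
  case (Suc N)
  then show ?case
    by (cases "\<alpha> N" rule: letter_cases; cases "content N \<alpha>")
      (simp_all add: content_def profiles_def)
qed (simp add: content_def profiles_def zero_prod_def)

lemma sum_words_Suc:
  "(\<Sum>\<alpha>\<in>words (Suc N). g \<alpha>) = (\<Sum>l\<in>UNIV. \<Sum>\<alpha>\<in>words N. g (\<alpha>(N := l)))"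
proof -
  have "words (Suc N) = (\<lambda>(l, \<alpha>). \<alpha>(N := l)) ` (UNIV \<times> words N)"
    unfolding words_def lessThan_Suc PiE_insert_eq by simp
  moreover have "inj_on (\<lambda>(l, \<alpha>). \<alpha>(N := l)) (UNIV \<times> words N)"
    unfolding words_def by (rule inj_combinator) simp
  ultimately show ?thesis
    by (simp add: sum.reindex sum.cartesian_product case_prod_unfold)
qed

lemma prod_fact_unit4_add: "prod_fact (unit4 l + q) = exponent_of l (unit4 l + q) * prod_fact q"
  by (cases l rule: letter_cases; cases q) (simp_all add: algebra_simps)

lemma exponent_of_split: "exponent_of l p \<noteq> 0 \<Longrightarrow> \<exists>q. p = unit4 l + q"
  by (cases l rule: letter_cases; cases p; auto simp: plus_prod_def)
    (metis Suc_pred' add.commute plus_1_eq_Suc)+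

lemma exponent_of_unit4_add: "exponent_of l (unit4 l + q) \<noteq> 0"
  by (cases l rule: letter_cases; cases q) simp_all

lemma profiles_unit4_add: "unit4 l + q \<in> profiles (Suc N) \<longleftrightarrow> q \<in> profiles N"
  by (cases l rule: letter_cases; cases q) (simp_all add: profiles_def)

lemma sum_exponents: "p \<in> profiles N \<Longrightarrow> (\<Sum>l\<in>UNIV. exponent_of l p) = N"
  by (cases p) (simp add: sum_letters profiles_def)

text \<open>This is the multinomial coefficient, in a form without division. Words of length
  \<open>N + 1\<close> with last letter \<open>l\<close> contribute
  \<open>exponent_of l p * fact N\<close>, and the exponents sum to \<open>N + 1\<close>.\<close>

lemma count_words:
  "p \<in> profiles N \<Longrightarrow> (\<Sum>\<alpha>\<in>words N. of_bool (content N \<alpha> = p)) * prod_fact p = fact N"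
proof (induction N arbitrary: p)
  case 0
  then show ?case by (cases p) (simp add: words_def content_def profiles_def zero_prod_def)
next
  case (Suc N)
  \<comment> \<open>A letter with exponent 0 cannot occur; any other one is removed, which divides
    \<open>prod_fact p\<close> by its exponent.\<close>
  have letter: "(\<Sum>\<alpha>\<in>words N. of_bool (unit4 l + content N \<alpha> = p)) * prod_fact p
      = exponent_of l p * fact N" for l
  proof (cases "exponent_of l p = 0")
    case True
    then have "unit4 l + content N \<alpha> \<noteq> p" for \<alpha> using exponent_of_unit4_add by metis
    with True show ?thesis by simp
  next
    case False
    then obtain q where q: "p = unit4 l + q" using exponent_of_split by blast
    then have "(\<Sum>\<alpha>\<in>words N. of_bool (content N \<alpha> = q)) * prod_fact q = fact N"
      using Suc profiles_unit4_add by blast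
    then show ?thesis unfolding q prod_fact_unit4_add by (simp add: mult_ac)
  qed
  have "content (Suc N) (\<alpha>(N := l)) = unit4 l + content N \<alpha>" for \<alpha> l
    by (simp add: content_def add.commute)
  then have "(\<Sum>\<alpha>\<in>words (Suc N). of_bool (content (Suc N) \<alpha> = p)) * prod_fact p
     = (\<Sum>l\<in>UNIV. exponent_of l p * fact N)"
    by (simp only: sum_words_Suc sum_distrib_right[of _ UNIV] letter)
  also have "\<dots> = fact (Suc N)"
    using sum_exponents[OF Suc.prems] by (simp add: sum_distrib_right[symmetric])
  finally show ?case .
qed

section \<open>Expansion of dual monomials\<close>

lemma prod_single:
  "(\<Prod>k<N. Poly_Mapping.single (e k) (c k)) = Poly_Mapping.single (\<Sum>k<N. e k) (\<Prod>k<N. c k)"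
  for c :: "nat \<Rightarrow> 'a::comm_semiring_1" and e :: "nat \<Rightarrow> 'b::comm_monoid_add"
  by (induction N) (simp_all add: mult_single)

definition primal_var :: "letter \<Rightarrow> poly4" where
  "primal_var l = Poly_Mapping.single (unit4 l) 1"

definition dual_var :: "letter \<Rightarrow> poly4" where
  "dual_var l = (\<Sum>c\<in>UNIV. Poly_Mapping.single (unit4 c) (letter_sign l c / 2))"

lemma primal_monomial: "monomial4 primal_var p = Poly_Mapping.single p 1"
proof -
  have pow: "Poly_Mapping.single e (1 :: complex) ^ n = Poly_Mapping.single (\<Sum>k<n. e) 1"
    for e :: "nat \<times> nat \<times> nat \<times> nat" and n
    using prod_single[where N = n and e = "\<lambda>_. e" and c = "\<lambda>_. 1 :: complex"] by simp
  have "(\<Sum>k<n. (a, b, c, d)) = (n * a, n * b, n * c, n * d)" for a b c d n :: nat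
    by (induction n) (simp_all add: zero_prod_def)
  then show ?thesis
    by (cases p) (simp add: primal_var_def pow mult_single)
qed

lemma vars_eq_primal_var:
  "varx = primal_var (False, False)" "vary = primal_var (True, True)"
  "varz = primal_var (False, True)" "varw = primal_var (True, False)"
  by (simp_all add: varx_def vary_def varz_def varw_def primal_var_def)

lemma vars_dual_eq_dual_var:
  "varx_dual = dual_var (False, False)" "vary_dual = dual_var (True, True)"
  "varz_dual = dual_var (False, True)" "varw_dual = dual_var (True, False)"
  by (simp_all add: varx_dual_def vary_dual_def varz_dual_def varw_dual_def dual_var_def
      sum_letters constp_def varx_def vary_def varz_def varw_def algebra_simps mult_single
      single_uminus)

text \<open>Choosing one term from each of the \<open>N\<close> linear forms spells a word
  \<open>\<beta>\<close>, whose content is the exponent of the resulting monomial. The word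
  \<open>\<alpha>\<close> represents the dual exponent, so that the signs can be read off position
  by position.\<close>

lemma lookup_dual_monomial:
  "Poly_Mapping.lookup (monomial4 dual_var (content N \<alpha>)) p
    = (1 / 2 ^ N) * (\<Sum>\<beta>\<in>{\<beta> \<in> words N. content N \<beta> = p}. \<Prod>k<N. letter_sign (\<alpha> k) (\<beta> k))"
proof -
  have "monomial4 dual_var (content N \<alpha>)
    = (\<Prod>k<N. \<Sum>c\<in>UNIV. Poly_Mapping.single (unit4 c) (letter_sign (\<alpha> k) c / 2))"
    by (simp only: prod_eq_monomial4[symmetric] dual_var_def)
  also have "\<dots> = (\<Sum>\<beta>\<in>words N. \<Prod>k<N. Poly_Mapping.single (unit4 (\<beta> k)) (letter_sign (\<alpha> k) (\<beta> k) / 2))"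
    unfolding words_def by (rule prod_sum_PiE) auto
  also have "\<dots> = (\<Sum>\<beta>\<in>words N. Poly_Mapping.single (content N \<beta>)
      ((1 / 2 ^ N) * (\<Prod>k<N. letter_sign (\<alpha> k) (\<beta> k))))"
    unfolding prod_single content_def by (simp add: prod_dividef)
  finally have "Poly_Mapping.lookup (monomial4 dual_var (content N \<alpha>)) p
    = (\<Sum>\<beta>\<in>words N. if content N \<beta> = p then (1 / 2 ^ N) * (\<Prod>k<N. letter_sign (\<alpha> k) (\<beta> k)) else 0)"
    by (simp add: lookup_sum lookup_single when_def cong: if_cong)
  also have "\<dots> = (1 / 2 ^ N) * (\<Sum>\<beta>\<in>{\<beta> \<in> words N. content N \<beta> = p}. \<Prod>k<N. letter_sign (\<alpha> k) (\<beta> k))"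
    unfolding sum_distrib_left by (rule sum.mono_neutral_cong_right) auto
  finally show ?thesis .
qed

text \<open>Both sides of the exchange count pairs of words of contents \<open>p\<close> and \<open>q\<close>, weighted by signs:
  by the expansion above, the sum over one word depends on the other one only through its content.\<close>

lemma dual_monomial_exchange:
  assumes "p \<in> profiles N"
  shows "Poly_Mapping.lookup (monomial4 dual_var p) (content N \<beta>) * of_nat (prod_fact (content N \<beta>))
    = of_nat (prod_fact p) *
      ((1 / 2 ^ N) * (\<Sum>\<alpha>\<in>{\<alpha> \<in> words N. content N \<alpha> = p}. \<Prod>k<N. letter_sign (\<alpha> k) (\<beta> k)))"
proof -
  let ?q = "content N \<beta>"
  let ?W = "\<lambda>p. {\<alpha> \<in> words N. content N \<alpha> = p}"
  let ?L = "\<lambda>p q. Poly_Mapping.lookup (monomial4 dual_var p) q"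
  let ?s = "\<lambda>\<alpha> \<beta>. \<Prod>k<N. letter_sign (\<alpha> k) (\<beta> k)"
  have s_sym: "?s \<alpha> \<beta> = ?s \<beta> \<alpha>" for \<alpha> \<beta>
    by (intro prod.cong refl letter_sign_sym)
  have card: "of_nat (card (?W p)) * of_nat (prod_fact p) = (fact N :: complex)"
    if "p \<in> profiles N" for p
  proof -
    have "card (?W p) * prod_fact p = fact N"
      using count_words[OF that] by (simp add: Int_def)
    then have "of_nat (card (?W p) * prod_fact p) = (of_nat (fact N) :: complex)" by (rule arg_cong)
    then show ?thesis unfolding of_nat_mult of_nat_fact .
  qed
  have row: "(\<Sum>\<beta>\<in>?W q. ?s \<alpha> \<beta>) = 2 ^ N * ?L p q" if "\<alpha> \<in> ?W p" for \<alpha> p q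
  proof -
    from that have p: "p = content N \<alpha>" by simp
    show ?thesis unfolding p lookup_dual_monomial by simp
  qed
  have pairs: "(\<Sum>\<alpha>\<in>?W p. \<Sum>\<beta>\<in>?W q. ?s \<alpha> \<beta>) = of_nat (card (?W p)) * (2 ^ N * ?L p q)" for p q
  proof -
    have "(\<Sum>\<alpha>\<in>?W p. \<Sum>\<beta>\<in>?W q. ?s \<alpha> \<beta>) = (\<Sum>\<alpha>\<in>?W p. 2 ^ N * ?L p q)"
      by (intro sum.cong refl row)
    then show ?thesis by simp
  qed
  have "(\<Sum>\<alpha>\<in>?W p. \<Sum>\<beta>\<in>?W ?q. ?s \<alpha> \<beta>) = (\<Sum>\<beta>\<in>?W ?q. \<Sum>\<alpha>\<in>?W p. ?s \<beta> \<alpha>)"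
    by (subst sum.swap) (intro sum.cong refl s_sym)
  then have eq: "of_nat (card (?W p)) * ?L p ?q = of_nat (card (?W ?q)) * ?L ?q p"
    unfolding pairs by simp
  have q: "?q \<in> profiles N" by (rule content_in_profiles)
  have nz: "of_nat (card (?W p)) \<noteq> (0 :: complex)"
    using card[OF assms] by (metis fact_nonzero mult_zero_left)
  \<comment> \<open>Times its factorials, each cardinality becomes \<open>fact N\<close>. This
    trades the factorials of \<open>?q\<close> for those of \<open>p\<close>, after which the
    cardinality of \<open>?W p\<close> cancels.\<close>
  have "of_nat (card (?W p)) * (?L p ?q * of_nat (prod_fact ?q))
     = (of_nat (card (?W ?q)) * of_nat (prod_fact ?q)) * ?L ?q p"
    using eq by (simp add: mult_ac)
  also have "\<dots> = of_nat (card (?W p)) * (of_nat (prod_fact p) * ?L ?q p)"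
    unfolding card[OF q] card[OF assms, symmetric] by (simp only: mult.assoc)
  finally have "?L p ?q * of_nat (prod_fact ?q) = of_nat (prod_fact p) * ?L ?q p"
    using nz mult_left_cancel by blast
  also have "?L ?q p = (1 / 2 ^ N) * (\<Sum>\<alpha>\<in>?W p. ?s \<alpha> \<beta>)"
    unfolding lookup_dual_monomial by (intro arg_cong2[where f = "(*)"] sum.cong refl s_sym)
  finally show ?thesis .
qed


section \<open>The image of a polynomial as a matrix\<close>

lemma card_less_Suc_Collect:
  "card {k. k < Suc N \<and> P k} = card {k. k < N \<and> P k} + of_bool (P N)"
proof -
  have "{k. k < Suc N \<and> P k} = (if P N then insert N {k. k < N \<and> P k} else {k. k < N \<and> P k})"
    by (auto simp: less_Suc_eq)
  then show ?thesis by simp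
qed

lemma content_eq_cards:
  "content N \<alpha> = (card {k. k < N \<and> \<alpha> k = (False, False)}, card {k. k < N \<and> \<alpha> k = (True, True)},
     card {k. k < N \<and> \<alpha> k = (False, True)}, card {k. k < N \<and> \<alpha> k = (True, False)})"
proof (induction N)
  case (Suc N)
  then show ?case
    by (cases "\<alpha> N" rule: letter_cases) (simp_all add: content_def card_less_Suc_Collect)
qed (simp add: content_def zero_prod_def)

text \<open>The first component is true for the letters of \<open>y\<close> and \<open>w\<close>,
  the second for those of \<open>y\<close> and \<open>z\<close>, and they differ for
  \<open>z\<close> and \<open>w\<close>.\<close>

lemma cards_of_content:
  "content N \<alpha> = (r, s, t, u) \<Longrightarrow>
     card {k. k < N \<and> fst (\<alpha> k)} = u + s \<and> card {k. k < N \<and> snd (\<alpha> k)} = s + t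
     \<and> card {k. k < N \<and> fst (\<alpha> k) \<noteq> snd (\<alpha> k)} = t + u"
proof (induction N arbitrary: r s t u)
  case (Suc N)
  obtain r' s' t' u' where q: "content N \<alpha> = (r', s', t', u')" by (cases "content N \<alpha>")
  show ?case
    using Suc.IH[OF q] Suc.prems q
    by (cases "\<alpha> N" rule: letter_cases) (auto simp: content_def card_less_Suc_Collect)
qed (simp add: content_def zero_prod_def)

text \<open>The pairwise sums of \<open>s\<close>, \<open>t\<close>, \<open>u\<close> determine
  these three numbers, and the length \<open>N\<close> then determines \<open>r\<close>.\<close>

lemma content_eq_iff:
  assumes "(r, s, t, u) \<in> profiles N"
  shows "content N \<alpha> = (r, s, t, u) \<longleftrightarrow>
     card {k. k < N \<and> fst (\<alpha> k)} = u + s \<and> card {k. k < N \<and> snd (\<alpha> k)} = s + t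
     \<and> card {k. k < N \<and> fst (\<alpha> k) \<noteq> snd (\<alpha> k)} = t + u"
proof -
  obtain r' s' t' u' where q: "content N \<alpha> = (r', s', t', u')" by (cases "content N \<alpha>")
  show ?thesis
    using cards_of_content[OF q] content_in_profiles[of N \<alpha>] assms unfolding q by (auto simp: profiles_def)
qed

text \<open>\<open>z\<close> comes first because it is the column index, whose distance from
  \<open>\<kappa>\<close> is to be \<open>u + s\<close>, the number of letters with true first
  component.\<close>

definition pair_word :: "vertex \<Rightarrow> vertex \<Rightarrow> vertex \<Rightarrow> nat \<Rightarrow> letter" where
  "pair_word \<kappa> y z k = (z k \<noteq> \<kappa> k, y k \<noteq> \<kappa> k)"

text \<open>Coordinates take two values only, so \<open>y\<close> and \<open>z\<close> agree
  wherever both differ from \<open>\<kappa>\<close>.\<close>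

lemma profile_eq_content:
  assumes "\<kappa> \<in> hypercube N" "y \<in> hypercube N" "z \<in> hypercube N"
  shows "profile N (\<kappa>, y, z) = content N (pair_word \<kappa> y z)"
proof -
  have "\<kappa> k \<noteq> y k \<and> y k = z k \<longleftrightarrow> z k \<noteq> \<kappa> k \<and> y k \<noteq> \<kappa> k"
    "y k \<noteq> z k \<and> z k = \<kappa> k \<longleftrightarrow> z k = \<kappa> k \<and> y k \<noteq> \<kappa> k" if "k < N" for k
    using hypercube_nth[OF assms(1) that] hypercube_nth[OF assms(2) that]
      hypercube_nth[OF assms(3) that] by auto
  then show ?thesis
    unfolding content_eq_cards profile.simps pair_word_def prod.inject
    by (intro conjI arg_cong[where f = card]) auto
qed

lemma hamming_pair_word:
  assumes "\<kappa> \<in> hypercube N" "y \<in> hypercube N" "z \<in> hypercube N"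
  shows "card {k. k < N \<and> fst (pair_word \<kappa> y z k)} = hamming N z \<kappa>"
    and "card {k. k < N \<and> snd (pair_word \<kappa> y z k)} = hamming N y \<kappa>"
    and "card {k. k < N \<and> fst (pair_word \<kappa> y z k) \<noteq> snd (pair_word \<kappa> y z k)} = hamming N y z"
proof -
  have "(z k \<noteq> \<kappa> k) \<noteq> (y k \<noteq> \<kappa> k) \<longleftrightarrow> y k \<noteq> z k" if "k < N" for k
    using hypercube_nth[OF assms(1) that] hypercube_nth[OF assms(2) that]
      hypercube_nth[OF assms(3) that] by auto
  then show "card {k. k < N \<and> fst (pair_word \<kappa> y z k) \<noteq> snd (pair_word \<kappa> y z k)} = hamming N y z"
    unfolding hamming_def pair_word_def by (intro arg_cong[where f = card]) auto
qed (simp_all add: hamming_def pair_word_def)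

lemma finite_profiles: "finite (profiles N)"
proof (rule finite_subset)
  show "profiles N \<subseteq> {..N} \<times> {..N} \<times> {..N} \<times> {..N}" by (auto simp: profiles_def)
qed simp

lemma finite_triples: "finite (triples N)"
  by (simp add: triples_def)

lemma B_vec_apply: "q \<in> triples N \<Longrightarrow> B_vec N p q = of_bool (profile N q = p)"
  by (simp add: B_vec_def sum_fun_apply basis_vec_def finite_triples)

lemma ddag_apply:
  assumes "q \<in> triples N" "profile N q \<in> profiles N"
  shows "ddag N f q = Poly_Mapping.lookup f (profile N q) *
    (complex_of_real (sqrt (fact N * 2 ^ N)) * (of_nat (prod_fact (profile N q)) / (fact N * 2 ^ N)))"
proof -
  have "B_tilde N p q = of_nat (prod_fact p) / (fact N * 2 ^ N) * of_bool (profile N q = p)" for p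
    by (cases p) (simp add: vscale_def B_vec_apply[OF assms(1)] del: profile.simps)
  then have "ddag N f q = (\<Sum>p\<in>profiles N. if p = profile N q then Poly_Mapping.lookup f p *
    (complex_of_real (sqrt (fact N * 2 ^ N)) * (of_nat (prod_fact p) / (fact N * 2 ^ N))) else 0)"
    unfolding ddag_def sum_fun_apply vscale_def by (intro sum.cong) auto
  then show ?thesis using assms finite_profiles[of N] by simp
qed

lemma eps_map_kern:
  assumes "\<kappa> \<in> hypercube N"
  shows "eps_map N \<kappa> a = kern N (\<lambda>y z. complex_of_real (2 powr (real N / 2)) * a (\<kappa>, y, z))"
proof -
  let ?c = "complex_of_real (2 powr (real N / 2))"
  \<comment> \<open>Each triple becomes a matrix supported on at most one position, so the entry of
    the sum at \<open>(y, z)\<close> comes from \<open>(\<kappa>, y, z)\<close> alone.\<close>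
  have "eps_map N \<kappa> a = (\<Sum>q\<in>triples N. kern N (\<lambda>y' z'. if q = (\<kappa>, y', z') then ?c * a q else 0))"
    unfolding eps_map_def
  proof (intro sum.cong refl, clarify)
    fix x y z assume "(x, y, z) \<in> triples N"
    then have yz: "y \<in> hypercube N" "z \<in> hypercube N" by (auto simp: triples_def)
    show "escale (a (x, y, z)) (if x = \<kappa> then escale ?c (elem_endo N y z) else 0)
      = kern N (\<lambda>y' z'. if (x, y, z) = (\<kappa>, y', z') then ?c * a (x, y, z) else 0)"
    proof (cases "x = \<kappa>")
      case True
      then show ?thesis
        using yz by (simp add: elem_endo_kern escale_kern) (intro kern_cong, auto)
    next
      case False
      then show ?thesis
        by (intro ext) (simp add: escale_def vscale_def kern_apply)
    qed
  qed
  also have "\<dots> = kern N (\<lambda>y z. ?c * a (\<kappa>, y, z))"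
    unfolding sum_kern
    by (rule kern_cong) (simp add: finite_triples triples_def assms)
  finally show ?thesis .
qed

text \<open>This computes the normalisation of \<open>eps_map\<close> after \<open>ddag\<close>: the
  powers of 2 cancel because \<open>2 powr (N / 2)\<close> is the root of \<open>2 ^ N\<close>, and
  \<open>fact N\<close> is the square of its root.\<close>

lemma vartheta_scalar:
  "complex_of_real (2 powr (real N / 2)) * (complex_of_real (sqrt (fact N * 2 ^ N)) * (c / (fact N * 2 ^ N)))
    = c / complex_of_real (sqrt (fact N))"
proof -
  have "2 powr (real N / 2) = sqrt (2 ^ N)"
    by (simp add: powr_half_sqrt[symmetric] powr_powr flip: powr_realpow)
  then have "2 powr (real N / 2) * sqrt (fact N * 2 ^ N) = sqrt (fact N) * 2 ^ N"
    by (simp add: real_sqrt_mult)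
  then have "complex_of_real (2 powr (real N / 2)) * complex_of_real (sqrt (fact N * 2 ^ N))
     = complex_of_real (sqrt (fact N)) * 2 ^ N"
    by (metis of_real_mult of_real_power of_real_numeral)
  then have "complex_of_real (2 powr (real N / 2)) * (complex_of_real (sqrt (fact N * 2 ^ N)) * (c / (fact N * 2 ^ N)))
    = complex_of_real (sqrt (fact N)) * c / fact N"
    by (simp add: mult.assoc[symmetric])
  moreover have "complex_of_real (sqrt (fact N)) * complex_of_real (sqrt (fact N)) = fact N"
    by (metis abs_of_nonneg fact_ge_zero of_real_fact of_real_mult real_sqrt_mult_self)
  moreover have "q * c / (q * q) = c / q" for q :: complex
    by simp
  ultimately show ?thesis
    by metis
qed

lemma vartheta_kern:
  assumes "\<kappa> \<in> hypercube N"
  shows "vartheta N \<kappa> f = kern N (\<lambda>y z. Poly_Mapping.lookup f (content N (pair_word \<kappa> y z)) *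
    of_nat (prod_fact (content N (pair_word \<kappa> y z))) / complex_of_real (sqrt (fact N)))"
  unfolding vartheta_def eps_map_kern[OF assms]
proof (rule kern_cong)
  fix y z assume yz: "y \<in> hypercube N" "z \<in> hypercube N"
  note pc = profile_eq_content[OF assms yz]
  have "ddag N f (\<kappa>, y, z) = Poly_Mapping.lookup f (profile N (\<kappa>, y, z)) *
    (complex_of_real (sqrt (fact N * 2 ^ N)) *
      (of_nat (prod_fact (profile N (\<kappa>, y, z))) / (fact N * 2 ^ N)))"
    using yz assms by (intro ddag_apply) (simp_all only: pc content_in_profiles, simp add: triples_def)
  then show "complex_of_real (2 powr (real N / 2)) * ddag N f (\<kappa>, y, z)
    = Poly_Mapping.lookup f (content N (pair_word \<kappa> y z)) *
      of_nat (prod_fact (content N (pair_word \<kappa> y z))) / complex_of_real (sqrt (fact N))"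
    by (simp only: pc) (subst mult.left_commute, simp only: vartheta_scalar, simp)
qed

section \<open>Images of the monomials in both sets of variables\<close>

lemma vartheta_monomial:
  assumes "\<kappa> \<in> hypercube N" "(r, s, t, u) \<in> profiles N"
  shows "vartheta N \<kappa> (monomial4 primal_var (r, s, t, u)) =
    escale (of_nat (prod_fact (r, s, t, u)) / complex_of_real (sqrt (fact N)))
      (E_dual N \<kappa> (s + t) \<circ> A_dist N (t + u) \<circ> E_dual N \<kappa> (u + s))"
proof -
  \<comment> \<open>The outer factors fix the distances of the row \<open>y\<close> and the column
    \<open>z\<close> from \<open>\<kappa>\<close>, the middle one their mutual distance; together
    these prescribe the content.\<close>
  have "E_dual N \<kappa> (s + t) \<circ> A_dist N (t + u) \<circ> E_dual N \<kappa> (u + s)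
    = kern N (\<lambda>y z. of_bool (content N (pair_word \<kappa> y z) = (r, s, t, u)))"
    unfolding E_dual_kern[OF assms(1)] A_dist_kern kern_diag_comp kern_comp_diag
    by (rule kern_cong, simp only: content_eq_iff[OF assms(2)] hamming_pair_word[OF assms(1)]) auto
  then show ?thesis
    unfolding primal_monomial vartheta_kern[OF assms(1)]
    by (simp only: escale_kern) (rule kern_cong, auto simp: lookup_single when_def simp del: prod_fact.simps)
qed

text \<open>\<open>ddag\<close> reads only the coefficients at \<open>profiles N\<close>, so the
  image of \<open>f\<close> is a combination of images of monomials, which are scaled products of
  elements of the algebra.\<close>

lemma vartheta_in_subconst:
  assumes "\<kappa> \<in> hypercube N"
  shows "vartheta N \<kappa> f \<in> subconst_alg N \<kappa>"
proof -
  have mono: "vartheta N \<kappa> (monomial4 primal_var p) \<in> subconst_alg N \<kappa>" if "p \<in> profiles N" for p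
    using that
    by (cases p) (simp only: vartheta_monomial[OF assms], intro subconst_alg.intros
        E_dual_in_subconst A_dist_in_subconst assms)
  have "vartheta N \<kappa> f = (\<Sum>p\<in>profiles N.
      escale (Poly_Mapping.lookup f p) (vartheta N \<kappa> (monomial4 primal_var p)))"
    unfolding vartheta_kern[OF assms] escale_kern sum_kern
  proof (rule kern_cong)
    fix y z
    let ?q = "content N (pair_word \<kappa> y z)"
    let ?w = "of_nat (prod_fact ?q) / complex_of_real (sqrt (fact N))"
    have "(\<Sum>p\<in>profiles N. Poly_Mapping.lookup f p *
        (Poly_Mapping.lookup (monomial4 primal_var p) ?q * of_nat (prod_fact ?q) / complex_of_real (sqrt (fact N))))
      = (\<Sum>p\<in>profiles N. if p = ?q then Poly_Mapping.lookup f p * ?w else 0)"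
      by (intro sum.cong) (auto simp: primal_monomial lookup_single when_def)
    also have "\<dots> = Poly_Mapping.lookup f ?q * of_nat (prod_fact ?q) / complex_of_real (sqrt (fact N))"
      by (simp add: finite_profiles content_in_profiles)
    finally show "Poly_Mapping.lookup f ?q * of_nat (prod_fact ?q) / complex_of_real (sqrt (fact N))
      = (\<Sum>p\<in>profiles N. Poly_Mapping.lookup f p *
        (Poly_Mapping.lookup (monomial4 primal_var p) ?q * of_nat (prod_fact ?q) / complex_of_real (sqrt (fact N))))"
      by (rule sym)
  qed
  then show ?thesis
    by (simp only:) (intro sum_in_subconst subconst_alg.scale mono)
qed

text \<open>A pair \<open>(S, T)\<close> corresponds to the word of its membership values. The
  content encodes the three cardinalities, and the signs are the local factors of the
  characters.\<close>

lemma sum_characters_eq_sum_words: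
  assumes "\<kappa> \<in> hypercube N" "y \<in> hypercube N" "z \<in> hypercube N" "(r, s, t, u) \<in> profiles N"
  shows "(\<Sum>(S, T) | S \<subseteq> {..<N} \<and> T \<subseteq> {..<N} \<and> card S = u + s \<and> card T = s + t
          \<and> card (S - T \<union> (T - S)) = t + u.
        (chi S y * chi S \<kappa>) * (chi T z * chi T \<kappa>))
    = (\<Sum>\<alpha>\<in>{\<alpha> \<in> words N. content N \<alpha> = (r, s, t, u)}.
        \<Prod>k<N. letter_sign (\<alpha> k) (pair_word \<kappa> y z k))"
    (is "sum ?f ?A = sum ?g ?B")
proof (rule sum.reindex_bij_witness[where
      i = "\<lambda>\<alpha>. ({k. k < N \<and> fst (\<alpha> k)}, {k. k < N \<and> snd (\<alpha> k)})" and
      j = "\<lambda>(S, T). restrict (\<lambda>k. (k \<in> S, k \<in> T)) {..<N}"])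
  fix P assume "P \<in> ?A"
  then obtain S T where P: "P = (S, T)" "S \<subseteq> {..<N}" "T \<subseteq> {..<N}" "card S = u + s"
    "card T = s + t" "card (S - T \<union> (T - S)) = t + u" by auto
  let ?\<alpha> = "restrict (\<lambda>k. (k \<in> S, k \<in> T)) {..<N}"
  have sets: "{k. k < N \<and> fst (?\<alpha> k)} = S" "{k. k < N \<and> snd (?\<alpha> k)} = T"
    "{k. k < N \<and> fst (?\<alpha> k) \<noteq> snd (?\<alpha> k)} = S - T \<union> (T - S)"
    using P by auto
  show "({k. k < N \<and> fst ((case P of (S, T) \<Rightarrow> restrict (\<lambda>k. (k \<in> S, k \<in> T)) {..<N}) k)},
      {k. k < N \<and> snd ((case P of (S, T) \<Rightarrow> restrict (\<lambda>k. (k \<in> S, k \<in> T)) {..<N}) k)}) = P"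
    by (simp only: P(1) prod.case sets)
  have "?\<alpha> \<in> words N" by (simp add: words_def PiE_iff)
  then show "(case P of (S, T) \<Rightarrow> restrict (\<lambda>k. (k \<in> S, k \<in> T)) {..<N}) \<in> ?B"
    by (simp only: P(1) prod.case mem_Collect_eq content_eq_iff[OF assms(4)] sets P(4-6))
  \<comment> \<open>\<open>y k * \<kappa> k\<close> is -1 exactly where the second component of the
    pair word is true, which \<open>letter_sign\<close> pairs with membership in \<open>S\<close>;
    likewise for \<open>z\<close>, the first component and \<open>T\<close>.\<close>
  have "(\<Prod>k<N. letter_sign (?\<alpha> k) (pair_word \<kappa> y z k)) =
    (\<Prod>k<N. ((if k \<in> S then of_int (y k) else 1) * (if k \<in> S then of_int (\<kappa> k) else 1)) *
      ((if k \<in> T then of_int (z k) else 1) * (if k \<in> T then of_int (\<kappa> k) else 1)))"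
  proof (rule prod.cong[OF refl])
    fix k assume "k \<in> {..<N}"
    then have "k < N" by simp
    then show "letter_sign (?\<alpha> k) (pair_word \<kappa> y z k) =
      ((if k \<in> S then of_int (y k) else 1) * (if k \<in> S then of_int (\<kappa> k) else 1)) *
      ((if k \<in> T then of_int (z k) else 1) * (if k \<in> T then of_int (\<kappa> k) else 1))"
      using hypercube_nth[OF assms(1), of k] hypercube_nth[OF assms(2), of k]
        hypercube_nth[OF assms(3), of k]
      by (auto simp: pair_word_def)
  qed
  then show "?g (case P of (S, T) \<Rightarrow> restrict (\<lambda>k. (k \<in> S, k \<in> T)) {..<N}) = ?f P"
    by (simp only: P(1) prod.case chi_eq_prod_lessThan[OF P(2)] chi_eq_prod_lessThan[OF P(3)]
        prod.distrib)
next
  fix \<alpha> assume "\<alpha> \<in> ?B"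
  then have w: "\<alpha> \<in> words N" and c: "content N \<alpha> = (r, s, t, u)" by auto
  let ?S = "{k. k < N \<and> fst (\<alpha> k)}" and ?T = "{k. k < N \<and> snd (\<alpha> k)}"
  have "?S - ?T \<union> (?T - ?S) = {k. k < N \<and> fst (\<alpha> k) \<noteq> snd (\<alpha> k)}" by auto
  then show "(?S, ?T) \<in> ?A"
    using cards_of_content[OF c] by auto
  show "(case (?S, ?T) of (S, T) \<Rightarrow> restrict (\<lambda>k. (k \<in> S, k \<in> T)) {..<N}) = \<alpha>"
    using w by (auto simp: words_def PiE_iff extensional_def fun_eq_iff)
qed

text \<open>The entry at \<open>(y, z)\<close> is the coefficient of the dual monomial at the
  content of the pair, times the factorials of that content. The exchange replaces these by the
  factorials of \<open>(r, s, t, u)\<close> and a sum over words, which is the character sum on the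
  right.\<close>

lemma vartheta_dual_monomial:
  assumes "\<kappa> \<in> hypercube N" "(r, s, t, u) \<in> profiles N"
  shows "vartheta N \<kappa> (monomial4 dual_var (r, s, t, u)) =
    escale (of_nat (prod_fact (r, s, t, u)) / complex_of_real (sqrt (fact N)))
      (E_idem N (u + s) \<circ> A_dual_dist N \<kappa> (t + u) \<circ> E_idem N (s + t))"
proof -
  have le: "u + s \<le> N" "t + u \<le> N" "s + t \<le> N" using assms(2) by (auto simp: profiles_def)
  show ?thesis
    unfolding idem_dual_idem_kern[OF assms(1) le] vartheta_kern[OF assms(1)] escale_kern
    by (rule kern_cong)
      (simp only: dual_monomial_exchange[OF assms(2)] sum_characters_eq_sum_words[OF assms(1) _ _ assms(2)]
        times_divide_eq_left)
qed

theorem theorem18p20: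
  fixes N r s t u h i j :: nat and \<kappa> :: vertex
  assumes "\<kappa> \<in> hypercube N"
    and "(r, s, t, u) \<in> profiles N"
    and "h = t + u" and "i = u + s" and "j = s + t"
  shows "vartheta N \<kappa> \<in> homog N \<rightarrow> subconst_alg N \<kappa>
    \<and> vartheta N \<kappa> (varx ^ r * vary ^ s * varz ^ t * varw ^ u) =
        escale (fact r * fact s * fact t * fact u / complex_of_real (sqrt (fact N)))
          (E_dual N \<kappa> j \<circ> A_dist N h \<circ> E_dual N \<kappa> i)
    \<and> vartheta N \<kappa> (varx_dual ^ r * vary_dual ^ s * varz_dual ^ t * varw_dual ^ u) =
        escale (fact r * fact s * fact t * fact u / complex_of_real (sqrt (fact N)))
          (E_idem N i \<circ> A_dual_dist N \<kappa> h \<circ> E_idem N j)"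
  using vartheta_monomial[OF assms(1,2)] vartheta_dual_monomial[OF assms(1,2)]
    vartheta_in_subconst[OF assms(1)]
  by (auto simp: assms(3-5) vars_eq_primal_var vars_dual_eq_dual_var)

end
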